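(* Let $S\in\mathbb{R}^{(n+1)\times(m+1)}$ with $\min(n,m)\ge 2$. Then $S\in \mathrm{SEP}(n+1,m+1)$ if and only if $S=\mathcal{W}^*(T)$ for some symmetric positive semidefinite $nm\times nm$ matrix $T$ satisfying $\langle T,J\rangle=0$ for all $J\in\mathcal{A}(n)\otimes\mathcal{A}(m)$.
   Context: All matrices are real; $\langle A,B\rangle=\mathrm{tr}(AB^T)$. Coordinates of vectors in $\mathbb{R}^r$, and rows and columns of matrices, are indexed starting from $0$; $e_i$ is the $i$th coordinate vector. $S^r$ denotes the symmetric $r\times r$ matrices. The Lorentz cone in $\mathbb{R}^r$ ($r\ge 3$) is $L_r=\{(y_0,\ldots,y_{r-1})^T : \sum_{i=1}^{r-1}y_i^2\le y_0^2,\ y_0\ge 0\}$. The Lorentz separable cone $\mathrm{SEP}(n+1,m+1)$ is the set of all $(n+1)\times(m+1)$ matrices that are finite sums $\sum_j y^j(x^j)^T$ with $y^j\in L_{n+1}$, $x^j\in L_{m+1}$. For $r\ge 3$ define the linear map $W_r:\mathbb{R}^r\to S^{r-1}$ by: $W_r(x)_{00}=x_0+x_1$; $W_r(x)_{ii}=x_0-x_1$ for $1\le i\le r-2$; $W_r(x)_{0i}=W_r(x)_{i0}=x_{i+1}$ for $1\le i\le r-2$; all other entries are $0$. The linear map $\mathcal{W}:\mathbb{R}^{(n+1)\times(m+1)}\to S^{nm}$ is $\mathcal{W}(A)=\sum_{i=0}^n\sum_{j=0}^m a_{ij}\,W_{n+1}(e_i)\otimes W_{m+1}(e_j)$, with $\otimes$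 the Kronecker product. Its adjoint $\mathcal{W}^*:S^{nm}\to\mathbb{R}^{(n+1)\times(m+1)}$ is $\mathcal{W}^*(T)_{ij}=\langle T, W_{n+1}(e_i)\otimes W_{m+1}(e_j)\rangle$. $\mathcal{A}(r)$ is the space of skew-symmetric $r\times r$ matrices, and $\mathcal{A}(n)\otimes\mathcal{A}(m)\subset S^{nm}$ is the linear span of all Kronecker products $B\otimes D$ with $B\in\mathcal{A}(n)$, $D\in\mathcal{A}(m)$. *)

theory Defs
  imports "Jordan_Normal_Form.VS_Connect"
begin

definition mat_trace :: "real mat \<Rightarrow> real" where
  "mat_trace A = (\<Sum>i<dim_row A. A $$ (i, i))"

definition mat_inner :: "real mat \<Rightarrow> real mat \<Rightarrow> real" where
  "mat_inner A B = mat_trace (A * transpose_mat B)"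

definition outer_prod :: "real vec \<Rightarrow> real vec \<Rightarrow> real mat" where
  "outer_prod y x = mat (dim_vec y) (dim_vec x) (\<lambda>(i, j). y $ i * x $ j)"

definition kron :: "real mat \<Rightarrow> real mat \<Rightarrow> real mat" where
  "kron A B = mat (dim_row A * dim_row B) (dim_col A * dim_col B)
     (\<lambda>(i, j). A $$ (i div dim_row B, j div dim_col B) * B $$ (i mod dim_row B, j mod dim_col B))"

definition sym_mats :: "nat \<Rightarrow> real mat set" where
  "sym_mats r = {A \<in> carrier_mat r r. transpose_mat A = A}"

definition skew_mats :: "nat \<Rightarrow> real mat set" where
  "skew_mats r = {A \<in> carrier_mat r r. transpose_mat A = - A}"

definition psd_mat :: "real mat \<Rightarrow> bool" where
  "psd_mat A \<longleftrightarrow> A \<in> sym_mats (dim_row A) \<and> (\<forall>v \<in> carrier_vec (dim_row A). 0 \<le> v \<bullet> (A *\<^sub>v v))"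

definition lorentz_cone :: "nat \<Rightarrow> real vec set" where
  "lorentz_cone r = {y \<in> carrier_vec r. (\<Sum>i = 1..<r. (y $ i)\<^sup>2) \<le> (y $ 0)\<^sup>2 \<and> 0 \<le> y $ 0}"

text \<open>The type of matrices of varying dimension is not a monoid under addition, so finite sums
  of matrices of one fixed size are written entrywise.\<close>

definition lorentz_sep :: "nat \<Rightarrow> nat \<Rightarrow> real mat set" where
  "lorentz_sep p q = {S. \<exists>(N::nat) y x.
     (\<forall>k<N. y k \<in> lorentz_cone p \<and> x k \<in> lorentz_cone q) \<and>
     S = mat p q (\<lambda>ij. \<Sum>k<N. outer_prod (y k) (x k) $$ ij)}"

definition lorentz_W :: "real vec \<Rightarrow> real mat" where
  "lorentz_W x = mat (dim_vec x - 1) (dim_vec x - 1) (\<lambda>(i, j).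
     if i = 0 \<and> j = 0 then x $ 0 + x $ 1
     else if i = j then x $ 0 - x $ 1
     else if i = 0 then x $ (j + 1)
     else if j = 0 then x $ (i + 1)
     else 0)"

definition W_basis :: "nat \<Rightarrow> nat \<Rightarrow> nat \<Rightarrow> nat \<Rightarrow> real mat" where
  "W_basis n m i j = kron (lorentz_W (unit_vec (n + 1) i)) (lorentz_W (unit_vec (m + 1) j))"

definition W_map :: "nat \<Rightarrow> nat \<Rightarrow> real mat \<Rightarrow> real mat" where
  "W_map n m A = mat (n * m) (n * m)
     (\<lambda>ab. \<Sum>i\<le>n. \<Sum>j\<le>m. A $$ (i, j) * W_basis n m i j $$ ab)"

definition W_adj :: "nat \<Rightarrow> nat \<Rightarrow> real mat \<Rightarrow> real mat" where
  "W_adj n m T = mat (n + 1) (m + 1) (\<lambda>(i, j). mat_inner T (W_basis n m i j))"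

text \<open>The linear span is taken in the vector space of all real $nm \times nm$ matrices.\<close>

definition skew_tensor :: "nat \<Rightarrow> nat \<Rightarrow> real mat set" where
  "skew_tensor n m =
     LinearCombinations.module.span class_ring (module_mat TYPE(real) (n * m) (n * m))
       {kron B D | B D. B \<in> skew_mats n \<and> D \<in> skew_mats m}"

lemma mat_inner_eq:
  assumes "A \<in> carrier_mat p q" "B \<in> carrier_mat p q"
  shows "mat_inner A B = (\<Sum>i<p. \<Sum>j<q. A $$ (i, j) * B $$ (i, j))"
proof -
  have "(A * transpose_mat B) $$ (i, i) = (\<Sum>j<q. A $$ (i, j) * B $$ (i, j))" if "i < p" for i
    using assms that by (simp add: scalar_prod_def atLeast0LessThan)
  then show ?thesis
    using assms by (simp add: mat_inner_def mat_trace_def)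
qed

lemma W_basis_carrier: "W_basis n m i j \<in> carrier_mat (n * m) (n * m)"
  by (simp add: W_basis_def kron_def lorentz_W_def)

lemma W_adj_adjoint:
  assumes A: "A \<in> carrier_mat (n + 1) (m + 1)" and T: "T \<in> carrier_mat (n * m) (n * m)"
  shows "mat_inner (W_map n m A) T = mat_inner A (W_adj n m T)"
proof -
  let ?N = "n * m"
  let ?W = "W_basis n m"
  have "mat_inner (W_map n m A) T =
      (\<Sum>a<?N. \<Sum>b<?N. (\<Sum>i\<le>n. \<Sum>j\<le>m. A $$ (i, j) * ?W i j $$ (a, b)) * T $$ (a, b))"
    using mat_inner_eq[OF _ T, of "W_map n m A"] by (simp add: W_map_def)
  also have "\<dots> = (\<Sum>a<?N. \<Sum>b<?N. \<Sum>i\<le>n. \<Sum>j\<le>m. A $$ (i, j) * (T $$ (a, b) * ?W i j $$ (a, b)))"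
    by (simp add: sum_distrib_right sum_distrib_left mult_ac)
  also have "\<dots> = (\<Sum>a<?N. \<Sum>i\<le>n. \<Sum>b<?N. \<Sum>j\<le>m. A $$ (i, j) * (T $$ (a, b) * ?W i j $$ (a, b)))"
    by (rule sum.cong[OF refl]) (rule sum.swap)
  also have "\<dots> = (\<Sum>i\<le>n. \<Sum>a<?N. \<Sum>b<?N. \<Sum>j\<le>m. A $$ (i, j) * (T $$ (a, b) * ?W i j $$ (a, b)))"
    by (rule sum.swap)
  also have "\<dots> = (\<Sum>i\<le>n. \<Sum>a<?N. \<Sum>j\<le>m. \<Sum>b<?N. A $$ (i, j) * (T $$ (a, b) * ?W i j $$ (a, b)))"
    by (intro sum.cong[OF refl]) (rule sum.swap)
  also have "\<dots> = (\<Sum>i\<le>n. \<Sum>j\<le>m. \<Sum>a<?N. \<Sum>b<?N. A $$ (i, j) * (T $$ (a, b) * ?W i j $$ (a, b)))"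
    by (intro sum.cong[OF refl]) (rule sum.swap)
  also have "\<dots> = (\<Sum>i\<le>n. \<Sum>j\<le>m. A $$ (i, j) * mat_inner T (?W i j))"
    by (simp add: mat_inner_eq[OF T W_basis_carrier] sum_distrib_left)
  also have "\<dots> = mat_inner A (W_adj n m T)"
    using mat_inner_eq[OF A, of "W_adj n m T"] by (simp add: W_adj_def lessThan_Suc_atMost)
  finally show ?thesis .
qed

end

theory Submission
  imports Defs "HOL-Analysis.Convex" "HOL-Analysis.Topology_Euclidean_Space"
begin

text \<open>For \<open>u \<in> \<real>\<^sup>n\<close> let \<open>N(u) = (|u|\<^sup>2, u\<^sub>0\<^sup>2 - |u'|\<^sup>2, 2 u\<^sub>0 u')\<close> with \<open>u = (u\<^sub>0, u')\<close>. These vectors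
  are exactly the boundary points of the Lorentz cone, and the \<open>k\<close>-th coordinate of \<open>N(u)\<close> is the
  quadratic form of \<open>W(e\<^sub>k)\<close> at \<open>u\<close>. Hence the adjoint of \<open>W\<close> sends the rank-one matrix
  \<open>(u \<otimes> v)(u \<otimes> v)\<^sup>T\<close> to \<open>N(u) N(v)\<^sup>T\<close>. As every point of the cone is a sum of two boundary points
  (\<open>ex_sum_null_vec\<close>), every separable matrix is the image of a sum of such matrices, and these are
  positive semidefinite and orthogonal to all products of skew matrices.

  For the converse, a symmetric \<open>T\<close> is orthogonal to all \<open>B \<otimes> D\<close> with skew \<open>B\<close> and \<open>D\<close> exactly
  if exchanging \<open>i\<close> and \<open>j\<close> does not change \<open>T\<^bsub>(i,a),(j,b)\<^esub>\<close>. By polarisation, the pairing of a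
  matrix \<open>Q\<close> with such a \<open>T\<close> depends only on the biquadratic form of \<open>Q\<close>
  (\<open>form4_eq_0_if_biquadratic_eq_0\<close>). The separable cone is closed and convex, so if the image of
  \<open>T\<close> were not separable, some matrix \<open>M\<close> that maps the one Lorentz cone into the other would pair
  negatively with it (\<open>separation_from_conic_hull\<close>). This contradicts \<open>T\<close> being positive
  semidefinite if the biquadratic form \<open>p(u,v) = N(u)\<^sup>T M N(v)\<close> of \<open>W(M)\<close> is a sum of squares of
  bilinear forms.

  It is enough to show this for \<open>M\<close> spanning an extreme ray, and, transposing if necessary, for
  \<open>m \<le> n\<close>. By the S-lemma there is \<open>c \<ge> 0\<close> with \<open>\<langle>Mx,Mx\<rangle> \<ge> c \<langle>x,x\<rangle>\<close> for the Lorentz forms and all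
  \<open>x\<close>. If \<open>c = 0\<close>, then \<open>M\<close> has rank one. If \<open>c > 0\<close> and the difference of the two sides is a nonzero
  form, this slack leaves room to perturb \<open>M\<close> by a matrix of rank one, so again \<open>M\<close> has rank one.
  In the remaining case \<open>M\<close> is conformal (\<open>extreme_positive_cases\<close>). For rank one, \<open>p\<close> is a product of two
  sums of squares of linear forms (\<open>gram_psd_rank_one\<close>). For conformal \<open>M\<close>, the form \<open>p(u,v)\<close> is,
  up to positive factors, a squared distance between a point and the image of another point under a
  conformal map of spheres, and the Lagrange identity turns it into a sum of squares
  (\<open>gram_psd_conformal\<close>).\<close>

section \<open>Closed convex cones in coordinate space\<close>

text \<open>The dimensions vary within the argument, so vectors are functions of which only the values on
  a finite index set \<open>I\<close> matter.\<close>

lemma bounded_family_convergent_subsequence: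
  fixes f :: "nat \<Rightarrow> 'i \<Rightarrow> real"
  assumes "finite I" "\<And>k i. i \<in> I \<Longrightarrow> \<bar>f k i\<bar> \<le> B"
  shows "\<exists>r l. strict_mono r \<and> (\<forall>i\<in>I. (\<lambda>k. f (r k) i) \<longlonglongrightarrow> l i)"
  using assms
proof (induction I rule: finite_induct)
  case empty
  then show ?case by (auto intro: exI[of _ id] simp: strict_mono_id)
next
  case (insert i I)
  obtain r l where r: "strict_mono (r :: nat \<Rightarrow> nat)" and l: "\<And>j. j \<in> I \<Longrightarrow> (\<lambda>k. f (r k) j) \<longlonglongrightarrow> l j"
    using insert by fastforce
  have "bounded (range (\<lambda>k. f (r k) i))"
    using insert.prems by (auto simp: bounded_iff)
  then obtain c s where s: "strict_mono (s :: nat \<Rightarrow> nat)" and c: "((\<lambda>k. f (r k) i) \<circ> s) \<longlonglongrightarrow> c"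
    using bounded_imp_convergent_subsequence by metis
  have "(\<lambda>k. f ((r \<circ> s) k) j) \<longlonglongrightarrow> (l(i := c)) j" if "j \<in> insert i I" for j
  proof (cases "j = i")
    case True
    then show ?thesis using c by (simp add: o_def)
  next
    case False
    then show ?thesis
      using LIMSEQ_subseq_LIMSEQ[OF l s] that by (simp add: o_def)
  qed
  moreover have "strict_mono (r \<circ> s)" using r s by (simp add: strict_mono_o)
  ultimately show ?case by blast
qed

text \<open>Values outside \<open>I\<close> are uncontrolled, so a sequence need not converge as a function; closedness
  of \<open>A\<close> therefore asks for a member of \<open>A\<close> that agrees with the limit on \<open>I\<close>.\<close>

lemma attains_min_on_closed_bounded:
  fixes A :: "('i \<Rightarrow> real) set" and \<phi> :: "('i \<Rightarrow> real) \<Rightarrow> real"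
  assumes fin: "finite I" and ne: "a0 \<in> A"
    and bd: "\<And>a i. a \<in> A \<Longrightarrow> i \<in> I \<Longrightarrow> \<bar>a i\<bar> \<le> B"
    and closed: "\<And>f. (\<And>k. f k \<in> A) \<Longrightarrow> (\<And>i. i \<in> I \<Longrightarrow> convergent (\<lambda>k. f k i)) \<Longrightarrow>
      \<exists>l\<in>A. \<forall>i\<in>I. (\<lambda>k. f k i) \<longlonglongrightarrow> l i"
    and cont: "\<And>f l. (\<And>i. i \<in> I \<Longrightarrow> (\<lambda>k. f k i) \<longlonglongrightarrow> l i) \<Longrightarrow> (\<lambda>k. \<phi> (f k)) \<longlonglongrightarrow> \<phi> l"
  shows "\<exists>a\<in>A. \<forall>b\<in>A. \<phi> a \<le> \<phi> b"
proof -
  have "seq_compact (\<phi> ` A)"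
    unfolding seq_compact_def
  proof (intro allI impI)
    fix g :: "nat \<Rightarrow> real"
    assume "\<forall>k. g k \<in> \<phi> ` A"
    then obtain f where f: "\<And>k. f k \<in> A" "\<And>k. g k = \<phi> (f k)"
      by (auto simp: image_iff) metis
    obtain r l where r: "strict_mono (r :: nat \<Rightarrow> nat)" and "\<And>i. i \<in> I \<Longrightarrow> (\<lambda>k. f (r k) i) \<longlonglongrightarrow> l i"
      using bounded_family_convergent_subsequence[OF fin, of f B] bd f by blast
    then obtain l' where "l' \<in> A" "\<And>i. i \<in> I \<Longrightarrow> (\<lambda>k. f (r k) i) \<longlonglongrightarrow> l' i"
      using closed[of "\<lambda>k. f (r k)"] f(1) by (auto simp: convergent_def) metis
    then show "\<exists>c\<in>\<phi> ` A. \<exists>r. strict_mono r \<and> (g \<circ> r) \<longlonglongrightarrow> c"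
      using cont[of "\<lambda>k. f (r k)" l'] r f(2) by (auto simp: o_def)
  qed
  then have "compact (\<phi> ` A)" by (simp add: seq_compact_eq_compact)
  with ne show ?thesis
    using compact_attains_inf[of "\<phi> ` A"] by auto
qed

text \<open>One step of Gaussian elimination removes one coordinate and one vector.\<close>

lemma linear_relation:
  fixes c :: "'k \<Rightarrow> 'i \<Rightarrow> real"
  assumes "finite I" "finite K" "card I < card K"
  shows "\<exists>a. (\<exists>k\<in>K. a k \<noteq> 0) \<and> (\<forall>i\<in>I. (\<Sum>k\<in>K. a k * c k i) = 0)"
  using assms
proof (induction I arbitrary: K c rule: finite_induct)
  case empty
  then show ?case by (intro exI[of _ "\<lambda>_. 1"]) (auto simp: card_gt_0_iff)
next
  case (insert i I)
  show ?case
  proof (cases "\<forall>k\<in>K. c k i = 0")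
    case True
    have "card I < card K" using insert by simp
    then obtain a where "\<exists>k\<in>K. a k \<noteq> 0" "\<forall>i\<in>I. (\<Sum>k\<in>K. a k * c k i) = 0"
      using insert.IH[OF insert.prems(1)] by blast
    then show ?thesis using True by (intro exI[of _ a]) simp
  next
    case False
    then obtain k0 where k0: "k0 \<in> K" "c k0 i \<noteq> 0" by blast
    define K' where "K' = K - {k0}"
    have K': "finite K'" "card I < card K'"
      using insert k0 by (auto simp: K'_def)
    obtain a where a: "\<exists>k\<in>K'. a k \<noteq> 0"
        "\<And>j. j \<in> I \<Longrightarrow> (\<Sum>k\<in>K'. a k * (c k j - c k i / c k0 i * c k0 j)) = 0"
      using insert.IH[OF K', of "\<lambda>k j. c k j - c k i / c k0 i * c k0 j"] by blast
    define s where "s = (\<Sum>k\<in>K'. a k * c k i) / c k0 i"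
    have sum_K: "(\<Sum>k\<in>K. (a(k0 := - s)) k * c k j) = (\<Sum>k\<in>K'. a k * c k j) - s * c k0 j" for j
    proof -
      have "(\<Sum>k\<in>K'. (a(k0 := - s)) k * c k j) = (\<Sum>k\<in>K'. a k * c k j)"
        by (intro sum.cong) (auto simp: K'_def)
      then show ?thesis
        using k0 insert.prems by (simp add: K'_def sum.remove[of K k0])
    qed
    have "(\<Sum>k\<in>K'. a k * c k j) = s * c k0 j" if "j \<in> I" for j
      using a(2)[OF that] by (simp add: s_def algebra_simps sum_subtractf sum_distrib_left sum_divide_distrib)
    moreover have "(\<Sum>k\<in>K'. a k * c k i) = s * c k0 i" using k0 by (simp add: s_def)
    ultimately have "\<forall>j\<in>insert i I. (\<Sum>k\<in>K. (a(k0 := - s)) k * c k j) = 0"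
      using sum_K by (metis insert_iff right_minus_eq)
    moreover have "\<exists>k\<in>K. (a(k0 := - s)) k \<noteq> 0" using a(1) by (auto simp: K'_def)
    ultimately show ?thesis by blast
  qed
qed

text \<open>A linear relation among more than \<open>card I\<close> summands allows the coefficients to be moved until
  one of them vanishes. The bound on the number of summands is independent of the sum, which is
  what makes the conic hull accessible to compactness.\<close>

lemma conic_caratheodory:
  fixes c :: "'k \<Rightarrow> 'i \<Rightarrow> real"
  assumes I: "finite I" and K: "finite K" and C: "\<And>k. k \<in> K \<Longrightarrow> c k \<in> C"
    and cone: "\<And>x r. x \<in> C \<Longrightarrow> 0 \<le> r \<Longrightarrow> (\<lambda>i. r * x i) \<in> C" and zero: "(\<lambda>_. 0) \<in> C"
  shows "\<exists>d. (\<forall>k. d k \<in> C) \<and> (\<forall>i\<in>I. (\<Sum>k\<in>K. c k i) = (\<Sum>k<card I. d k i))"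
  using K C
proof (induction "card K" arbitrary: K c rule: less_induct)
  case less
  show ?case
  proof (cases "card K \<le> card I")
    case True
    obtain h where h: "bij_betw h {..<card K} K"
      using ex_bij_betw_nat_finite[OF less.prems(1)] by (auto simp: atLeast0LessThan)
    define d where "d k = (if k < card K then c (h k) else (\<lambda>_. 0))" for k
    have "(\<Sum>k<card I. d k i) = (\<Sum>k\<in>K. c k i)" for i
    proof -
      have "(\<Sum>k<card I. d k i) = (\<Sum>k<card K. d k i)"
        using True by (intro sum.mono_neutral_right) (auto simp: d_def)
      also have "\<dots> = (\<Sum>k<card K. c (h k) i)" by (simp add: d_def)
      also have "\<dots> = (\<Sum>k\<in>K. c k i)" using h by (rule sum.reindex_bij_betw)
      finally show ?thesis .
    qed
    moreover have "d k \<in> C" for k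
      using less.prems(2) zero h by (auto simp: d_def bij_betw_def)
    ultimately show ?thesis by (intro exI[of _ d]) auto
  next
    case False
    then obtain b where b: "\<exists>k\<in>K. b k \<noteq> 0" "\<And>i. i \<in> I \<Longrightarrow> (\<Sum>k\<in>K. b k * c k i) = 0"
      using linear_relation[OF I less.prems(1), of c] by auto
    obtain a where a: "\<exists>k\<in>K. a k > 0" "\<And>i. i \<in> I \<Longrightarrow> (\<Sum>k\<in>K. a k * c k i) = 0"
    proof (cases "\<exists>k\<in>K. b k > 0")
      case True
      with b that show ?thesis by blast
    next
      case False
      then have "\<exists>k\<in>K. - b k > 0" using b(1) by force
      then show ?thesis using b(2) by (intro that[of "\<lambda>k. - b k"]) (auto simp: sum_negf)
    qed
    \<comment> \<open>Subtracting \<open>1 / a k0\<close> times the relation keeps all coefficients nonnegative and kills that of \<open>k0\<close>.\<close>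
    have "Max (a ` K) \<in> a ` K" using less.prems(1) a(1) by (intro Max_in) auto
    then obtain k0 where k0_Max: "k0 \<in> K" "a k0 = Max (a ` K)" by auto
    then have k0: "k0 \<in> K" "\<And>k. k \<in> K \<Longrightarrow> a k \<le> a k0"
      using less.prems(1) by auto
    have pos: "a k0 > 0" using a(1) k0 by force
    define d where "d k = (\<lambda>i. (1 - a k / a k0) * c k i)" for k
    have "card (K - {k0}) < card K" using less.prems(1) k0(1) by (meson card_Diff1_less)
    moreover have "d k \<in> C" if "k \<in> K - {k0}" for k
      unfolding d_def using that less.prems k0 pos by (intro cone) auto
    ultimately obtain e where e: "\<forall>k. e k \<in> C"
        "\<And>i. i \<in> I \<Longrightarrow> (\<Sum>k\<in>K - {k0}. d k i) = (\<Sum>k<card I. e k i)"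
      using less.hyps[of "K - {k0}" d] less.prems(1) by auto
    have "(\<Sum>k\<in>K. c k i) = (\<Sum>k\<in>K - {k0}. d k i)" if "i \<in> I" for i
    proof -
      have "(\<Sum>k\<in>K - {k0}. d k i) = (\<Sum>k\<in>K. d k i)"
        using k0(1) less.prems(1) pos by (simp add: sum.remove[of K k0] d_def)
      also have "\<dots> = (\<Sum>k\<in>K. c k i) - (\<Sum>k\<in>K. a k * c k i) / a k0"
        by (simp add: d_def algebra_simps sum_subtractf sum_divide_distrib)
      finally show ?thesis using a(2)[OF that] by simp
    qed
    with e show ?thesis by (intro exI[of _ e]) simp
  qed
qed

text \<open>The first-order optimality condition at a minimum of a quadratic function.\<close>

lemma nonneg_if_perturbation_nonneg:
  fixes q r :: real
  assumes "\<And>e. 0 < e \<Longrightarrow> e \<le> 1 \<Longrightarrow> 0 \<le> 2 * e * q + e\<^sup>2 * r"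
  shows "0 \<le> q"
proof (rule ccontr)
  assume q: "\<not> 0 \<le> q"
  define e where "e = min 1 (- q / (\<bar>r\<bar> + 1))"
  have e: "0 < e" "e \<le> 1" using q by (auto simp: e_def divide_neg_pos)
  have "e * \<bar>r\<bar> \<le> - q / (\<bar>r\<bar> + 1) * \<bar>r\<bar>" by (intro mult_right_mono) (auto simp: e_def)
  also have "\<dots> \<le> - q" using q by (simp add: field_simps)
  finally have "e * r \<le> - q" using e abs_ge_self[of r] by (smt (verit) mult_left_mono)
  then have "2 * q + e * r < 0" using q by linarith
  then have "e * (2 * q + e * r) < 0" using e by (simp add: mult_less_0_iff)
  then show False using assms[OF e] by (simp add: algebra_simps power2_eq_square)
qed

text \<open>The functional is \<open>Z - s\<close> for a point \<open>Z\<close> of the conic hull nearest to \<open>s\<close>. Such a point exists: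
  sums of \<open>card I\<close> elements of \<open>C\<close> suffice, and the coordinate \<open>i0\<close>, which dominates all others and
  is nonnegative on \<open>C\<close>, bounds every summand once the sum is bounded.\<close>

lemma separation_from_conic_hull:
  fixes C :: "('i \<Rightarrow> real) set" and s :: "'i \<Rightarrow> real"
  assumes I: "finite I"
    and cone: "\<And>x r. x \<in> C \<Longrightarrow> 0 \<le> r \<Longrightarrow> (\<lambda>i. r * x i) \<in> C" and zero: "(\<lambda>_. 0) \<in> C"
    and closed: "\<And>f. (\<And>k. f k \<in> C) \<Longrightarrow> (\<And>i. i \<in> I \<Longrightarrow> convergent (\<lambda>k. f k i)) \<Longrightarrow>
      \<exists>l\<in>C. \<forall>i\<in>I. (\<lambda>k. f k i) \<longlonglongrightarrow> l i"
    and i0: "i0 \<in> I" and dom: "\<And>c i. c \<in> C \<Longrightarrow> i \<in> I \<Longrightarrow> \<bar>c i\<bar> \<le> c i0"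
    and notin: "\<And>N c. (\<And>k. c k \<in> C) \<Longrightarrow> \<not> (\<forall>i\<in>I. s i = (\<Sum>k<(N::nat). c k i))"
  shows "\<exists>M. (\<forall>c\<in>C. 0 \<le> (\<Sum>i\<in>I. M i * c i)) \<and> (\<Sum>i\<in>I. M i * s i) < 0"
proof -
  define D where "D = card I"
  define Z where "Z d i = (\<Sum>k<D. d (k, i))" for d :: "nat \<times> 'i \<Rightarrow> real" and i
  define \<psi> where "\<psi> w = (\<Sum>i\<in>I. (w i - s i)\<^sup>2)" for w
  define b where "b = \<bar>s i0\<bar> + 1 + \<psi> (\<lambda>_. 0)"
  define A where "A = {d. (\<forall>k<D. (\<lambda>i. d (k, i)) \<in> C) \<and> Z d i0 \<le> b}"
  have psi_nonneg: "0 \<le> \<psi> w" for w by (simp add: \<psi>_def sum_nonneg)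
  have nonneg: "0 \<le> c i0" if "c \<in> C" for c using dom[OF that i0] by linarith
  have zA: "(\<lambda>_. 0) \<in> A" using zero psi_nonneg[of "\<lambda>_. 0"] by (auto simp: A_def Z_def b_def)
  have "\<exists>d\<in>A. \<forall>e\<in>A. \<psi> (Z d) \<le> \<psi> (Z e)"
  proof (rule attains_min_on_closed_bounded[of "{..<D} \<times> I" "\<lambda>_. 0" A b])
    fix d and x :: "nat \<times> 'i" assume d: "d \<in> A" and x: "x \<in> {..<D} \<times> I"
    obtain k i where ki: "x = (k, i)" "k < D" "i \<in> I" using x by auto
    have "\<bar>d (k, i)\<bar> \<le> d (k, i0)" using d ki dom by (auto simp: A_def)
    also have "\<dots> \<le> Z d i0" unfolding Z_def
      using d ki nonneg by (intro member_le_sum) (auto simp: A_def)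
    also have "\<dots> \<le> b" using d by (simp add: A_def)
    finally show "\<bar>d x\<bar> \<le> b" by (simp add: ki)
  next
    fix f :: "nat \<Rightarrow> nat \<times> 'i \<Rightarrow> real"
    assume f: "\<And>p. f p \<in> A" and conv: "\<And>x. x \<in> {..<D} \<times> I \<Longrightarrow> convergent (\<lambda>p. f p x)"
    have "\<exists>l\<in>C. \<forall>i\<in>I. (\<lambda>p. f p (k, i)) \<longlonglongrightarrow> l i" if "k < D" for k
      using f conv that by (intro closed) (auto simp: A_def)
    then obtain l where l: "\<And>k. k < D \<Longrightarrow> l k \<in> C"
        "\<And>k i. k < D \<Longrightarrow> i \<in> I \<Longrightarrow> (\<lambda>p. f p (k, i)) \<longlonglongrightarrow> l k i" by metis
    have "(\<lambda>p. Z (f p) i0) \<longlonglongrightarrow> (\<Sum>k<D. l k i0)"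
      unfolding Z_def using l(2) i0 by (intro tendsto_sum) auto
    then have "(\<Sum>k<D. l k i0) \<le> b"
      using f by (intro LIMSEQ_le_const2) (auto simp: A_def)
    then show "\<exists>l\<in>A. \<forall>x\<in>{..<D} \<times> I. (\<lambda>p. f p x) \<longlonglongrightarrow> l x"
      using l by (intro bexI[of _ "\<lambda>(k, i). l k i"]) (auto simp: A_def Z_def)
  next
    fix f :: "nat \<Rightarrow> nat \<times> 'i \<Rightarrow> real" and l
    assume "\<And>x. x \<in> {..<D} \<times> I \<Longrightarrow> (\<lambda>p. f p x) \<longlonglongrightarrow> l x"
    then show "(\<lambda>p. \<psi> (Z (f p))) \<longlonglongrightarrow> \<psi> (Z l)"
      unfolding \<psi>_def Z_def by (intro tendsto_intros) auto
  qed (use I zA in auto)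
  then obtain d where d: "d \<in> A" and min_A: "\<And>e. e \<in> A \<Longrightarrow> \<psi> (Z d) \<le> \<psi> (Z e)" by blast
  \<comment> \<open>Sums too far out to lie in \<open>A\<close> are beaten by the sum 0.\<close>
  have min_all: "\<psi> (Z d) \<le> \<psi> (\<lambda>i. \<Sum>k\<in>K. c k i)"
    if K: "finite K" "\<And>k. k \<in> K \<Longrightarrow> c k \<in> C" for K :: "nat set" and c
  proof -
    obtain e where e: "\<forall>k. e k \<in> C" "\<And>i. i \<in> I \<Longrightarrow> (\<Sum>k\<in>K. c k i) = (\<Sum>k<D. e k i)"
      using conic_caratheodory[OF I K(1), of c C] K(2) cone zero unfolding D_def by blast
    define e' where "e' = (\<lambda>(k, i). e k i)"
    have eq: "\<psi> (\<lambda>i. \<Sum>k\<in>K. c k i) = \<psi> (Z e')"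
      unfolding \<psi>_def Z_def e'_def using e(2) by (intro sum.cong) auto
    show ?thesis
    proof (cases "Z e' i0 \<le> b")
      case True
      then show ?thesis using min_A[of e'] e(1) eq by (auto simp: A_def e'_def)
    next
      case False
      then have "1 + \<psi> (\<lambda>_. 0) \<le> Z e' i0 - s i0" by (simp add: b_def)
      then have "(1 + \<psi> (\<lambda>_. 0))\<^sup>2 \<le> (Z e' i0 - s i0)\<^sup>2"
        using psi_nonneg[of "\<lambda>_. 0"] by (intro power_mono) auto
      also have "\<dots> \<le> \<psi> (Z e')" unfolding \<psi>_def using I i0 by (intro member_le_sum) auto
      finally have "\<psi> (\<lambda>_. 0) \<le> \<psi> (Z e')"
        using psi_nonneg[of "\<lambda>_. 0"] by (simp add: power2_eq_square algebra_simps)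
          (smt (verit) mult_nonneg_nonneg)
      moreover have "\<psi> (Z d) \<le> \<psi> (\<lambda>_. 0)" using min_A[OF zA] by (simp add: Z_def[abs_def])
      ultimately show ?thesis by (simp add: eq)
    qed
  qed
  define M where "M i = Z d i - s i" for i
  have expand: "\<psi> (\<lambda>i. Z d i + e * c i) = \<psi> (Z d) + (2 * e * (\<Sum>i\<in>I. M i * c i) + e\<^sup>2 * (\<Sum>i\<in>I. (c i)\<^sup>2))" for e c
  proof -
    have "(Z d i + e * c i - s i)\<^sup>2 = (Z d i - s i)\<^sup>2 + (2 * e * (M i * c i) + e\<^sup>2 * (c i)\<^sup>2)" for i
      by (simp add: M_def power2_eq_square algebra_simps)
    then show ?thesis by (simp add: \<psi>_def sum.distrib sum_distrib_left)
  qed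
  have dC: "(\<lambda>i. d (k, i)) \<in> C" if "k < D" for k using d that by (simp add: A_def)
  have "0 \<le> (\<Sum>i\<in>I. M i * c i)" if c: "c \<in> C" for c
  proof (rule nonneg_if_perturbation_nonneg)
    fix e :: real assume e: "0 < e"
    define f where "f k = (if k < D then (\<lambda>i. d (k, i)) else (\<lambda>i. e * c i))" for k
    have "\<psi> (Z d) \<le> \<psi> (\<lambda>i. \<Sum>k\<in>{..<Suc D}. f k i)"
      using dC cone[OF c] e by (intro min_all) (auto simp: f_def)
    also have "(\<lambda>i. \<Sum>k\<in>{..<Suc D}. f k i) = (\<lambda>i. Z d i + e * c i)"
      by (simp add: f_def Z_def)
    finally show "0 \<le> 2 * e * (\<Sum>i\<in>I. M i * c i) + e\<^sup>2 * (\<Sum>i\<in>I. (c i)\<^sup>2)"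
      by (simp add: expand)
  qed
  moreover have "0 \<le> (\<Sum>i\<in>I. M i * - Z d i)"
  proof (rule nonneg_if_perturbation_nonneg)
    fix e :: real assume e: "0 < e" "e \<le> 1"
    have "\<psi> (Z d) \<le> \<psi> (\<lambda>i. \<Sum>k\<in>{..<D}. (1 - e) * d (k, i))"
      using cone[OF dC] e by (intro min_all) auto
    also have "(\<lambda>i. \<Sum>k\<in>{..<D}. (1 - e) * d (k, i)) = (\<lambda>i. Z d i + e * - Z d i)"
      by (simp add: Z_def sum_distrib_left sum_subtractf algebra_simps)
    finally show "0 \<le> 2 * e * (\<Sum>i\<in>I. M i * - Z d i) + e\<^sup>2 * (\<Sum>i\<in>I. (- Z d i)\<^sup>2)"
      unfolding expand by simp
  qed
  moreover have "0 < (\<Sum>i\<in>I. (M i)\<^sup>2)"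
  proof -
    define f where "f k = (if k < D then (\<lambda>i. d (k, i)) else (\<lambda>_. 0))" for k
    have "f k \<in> C" for k using dC zero by (simp add: f_def)
    then obtain i where "i \<in> I" "s i \<noteq> (\<Sum>k<D. f k i)" using notin by blast
    then have "i \<in> I" "M i \<noteq> 0" by (auto simp: M_def Z_def f_def)
    then show ?thesis using I by (intro sum_pos2[of I i]) auto
  qed
  moreover have "(\<Sum>i\<in>I. M i * s i) = - (\<Sum>i\<in>I. M i * - Z d i) - (\<Sum>i\<in>I. (M i)\<^sup>2)"
    by (simp add: M_def power2_eq_square sum_subtractf[symmetric] sum_negf[symmetric] algebra_simps)
  ultimately show ?thesis by (intro exI[of _ M]) auto
qed

section \<open>The Lorentz cone and Lorentz-positive matrices\<close>

text \<open>A vector of \<open>\<real>\<^bsup>n+1\<^esup>\<close> is a function on the naturals of which the values at \<open>0..n\<close> count.\<close>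

definition euclid :: "nat \<Rightarrow> (nat \<Rightarrow> real) \<Rightarrow> (nat \<Rightarrow> real) \<Rightarrow> real" where
  "euclid n x y = (\<Sum>i\<le>n. x i * y i)"

definition minkowski :: "nat \<Rightarrow> (nat \<Rightarrow> real) \<Rightarrow> (nat \<Rightarrow> real) \<Rightarrow> real" where
  "minkowski n x y = x 0 * y 0 - (\<Sum>i=1..n. x i * y i)"

definition forward :: "nat \<Rightarrow> (nat \<Rightarrow> real) \<Rightarrow> bool" where
  "forward n x \<longleftrightarrow> 0 \<le> minkowski n x x \<and> 0 \<le> x 0"

definition mat_app :: "nat \<Rightarrow> (nat \<Rightarrow> nat \<Rightarrow> real) \<Rightarrow> (nat \<Rightarrow> real) \<Rightarrow> nat \<Rightarrow> real" where
  "mat_app m M x i = (\<Sum>j\<le>m. M i j * x j)"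

definition reflect :: "(nat \<Rightarrow> real) \<Rightarrow> nat \<Rightarrow> real" where
  "reflect x i = (if i = 0 then x i else - x i)"

definition coord :: "nat \<Rightarrow> nat \<Rightarrow> real" where
  "coord k i = (if i = k then 1 else 0)"

lemma sum_atMost_split_0: "(\<Sum>i\<le>n. f i) = f 0 + (\<Sum>i=1..n. f i)" for f :: "nat \<Rightarrow> real"
  by (simp add: atMost_atLeast0 sum.atLeast_Suc_atMost)

lemma euclid_eq: "euclid n x y = x 0 * y 0 + (\<Sum>i=1..n. x i * y i)"
  by (simp add: euclid_def sum_atMost_split_0)

lemma minkowski_eq_euclid: "minkowski n x y = euclid n (reflect x) y"
  by (simp add: euclid_eq minkowski_def reflect_def sum_negf[symmetric])

lemma reflect_reflect [simp]: "reflect (reflect x) = x"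
  by (auto simp: reflect_def)

lemma minkowski_commute: "minkowski n x y = minkowski n y x"
  by (simp add: minkowski_def mult.commute)

lemma euclid_commute: "euclid n x y = euclid n y x"
  by (simp add: euclid_def mult.commute)

lemma euclid_combination: "euclid n z (\<lambda>i. a * x i + b * y i) = a * euclid n z x + b * euclid n z y"
  by (simp add: euclid_def sum.distrib sum_distrib_left algebra_simps)

lemma minkowski_combination: "minkowski n z (\<lambda>i. a * x i + b * y i) = a * minkowski n z x + b * minkowski n z y"
  by (simp add: minkowski_eq_euclid euclid_combination)

lemma minkowski_combination_self:
  "minkowski n (\<lambda>i. a * x i + b * y i) (\<lambda>i. a * x i + b * y i)
    = a\<^sup>2 * minkowski n x x + 2 * a * b * minkowski n x y + b\<^sup>2 * minkowski n y y"
  by (simp add: minkowski_combination minkowski_commute[of n "\<lambda>i. a * x i + b * y i"] minkowski_commute[of n y x]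
      power2_eq_square algebra_simps)

lemma mat_app_combination: "mat_app m M (\<lambda>i. a * x i + b * y i) = (\<lambda>i. a * mat_app m M x i + b * mat_app m M y i)"
  by (rule ext) (simp add: mat_app_def sum.distrib sum_distrib_left algebra_simps)

lemma euclid_mat_app: "euclid n y (mat_app m M x) = euclid m (\<lambda>j. \<Sum>i\<le>n. y i * M i j) x"
  unfolding euclid_def mat_app_def sum_distrib_left sum_distrib_right
  by (subst sum.swap) (simp add: mult_ac)

lemma euclid_mat_app_sum: "euclid n y (mat_app m M x) = (\<Sum>i\<le>n. \<Sum>j\<le>m. M i j * y i * x j)"
  by (simp add: euclid_def mat_app_def sum_distrib_left mult_ac)

lemma sum_mult_indicator: "finite A \<Longrightarrow> (\<Sum>j\<in>A. f j * coord k j) = (if k \<in> A then f k else 0)"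
  by (simp add: coord_def if_distrib cong: if_cong)

lemma mat_app_coord: "k \<le> m \<Longrightarrow> mat_app m M (coord k) = (\<lambda>i. M i k)"
  by (rule ext) (simp add: mat_app_def sum_mult_indicator)

lemma euclid_coord: "k \<le> n \<Longrightarrow> euclid n x (coord k) = x k"
  by (simp add: euclid_def sum_mult_indicator)

lemma forward_coord0: "forward n (coord 0)"
  by (simp add: forward_def minkowski_def coord_def)

lemma minkowski_coord0: "minkowski n (coord 0) x = x 0"
  by (simp add: minkowski_def coord_def)

lemma forward_iff: "forward n x \<longleftrightarrow> (\<Sum>i=1..n. (x i)\<^sup>2) \<le> (x 0)\<^sup>2 \<and> 0 \<le> x 0"
  by (simp add: forward_def minkowski_def power2_eq_square)

lemma forward_add_coord:
  assumes "1 \<le> i" "i \<le> n" "s = 1 \<or> s = -1"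
  shows "forward n (\<lambda>k. coord 0 k + s * coord i k)"
proof -
  have "(\<Sum>k=1..n. (coord 0 k + s * coord i k)\<^sup>2) = (\<Sum>k=1..n. coord i k)"
    using assms by (intro sum.cong) (auto simp: coord_def)
  also have "\<dots> = 1" using assms sum_mult_indicator[of "{1..n}" "\<lambda>_. 1" i] by simp
  finally show ?thesis using assms by (auto simp: forward_iff coord_def)
qed

text \<open>Together with the next lemma: the Lorentz cone is self-dual.\<close>

lemma forward_pairing_nonneg:
  assumes "forward n x" "forward n y"
  shows "0 \<le> euclid n x y"
proof -
  have "(\<Sum>i=1..n. x i * y i)\<^sup>2 \<le> (\<Sum>i=1..n. (x i)\<^sup>2) * (\<Sum>i=1..n. (y i)\<^sup>2)"
    by (rule Cauchy_Schwarz_ineq_sum)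
  also have "\<dots> \<le> (x 0)\<^sup>2 * (y 0)\<^sup>2"
    using assms by (intro mult_mono) (auto simp: forward_iff sum_nonneg)
  also have "\<dots> = (x 0 * y 0)\<^sup>2" by (simp add: power_mult_distrib)
  finally have "\<bar>\<Sum>i=1..n. x i * y i\<bar> \<le> \<bar>x 0 * y 0\<bar>" by (simp add: abs_le_square_iff)
  moreover have "0 \<le> x 0 * y 0" using assms by (simp add: forward_def)
  ultimately show ?thesis by (simp add: euclid_eq)
qed

text \<open>Pairing \<open>z\<close> with the time axis and with the null vector whose spatial part is opposite to that of
  \<open>z\<close> gives the two conditions.\<close>

lemma forward_if_dual:
  assumes "\<And>y. forward n y \<Longrightarrow> 0 \<le> euclid n y z"
  shows "forward n z"
proof -
  define q where "q = (\<Sum>i=1..n. (z i)\<^sup>2)"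
  have q: "0 \<le> q" by (simp add: q_def sum_nonneg)
  have z0: "0 \<le> z 0" using assms[OF forward_coord0] euclid_coord[of 0 n z] by (simp add: euclid_commute)
  define y where "y i = (if i = 0 then sqrt q else - z i)" for i
  have "forward n y" using q by (simp add: forward_iff y_def q_def)
  then have "sqrt q * sqrt q \<le> sqrt q * z 0"
    using assms[of y] q by (simp add: euclid_eq y_def q_def sum_negf power2_eq_square)
  then have "sqrt q \<le> z 0" using z0 q mult_left_le_imp_le[of "sqrt q" "sqrt q" "z 0"] by (cases "q = 0") auto
  then have "q \<le> (z 0)\<^sup>2" using q z0 real_le_rsqrt sqrt_le_D by blast
  then show ?thesis using z0 by (simp add: forward_iff q_def)
qed

definition lorentz_positive :: "nat \<Rightarrow> nat \<Rightarrow> (nat \<Rightarrow> nat \<Rightarrow> real) \<Rightarrow> bool" where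
  "lorentz_positive n m M \<longleftrightarrow> (\<forall>x y. forward n y \<longrightarrow> forward m x \<longrightarrow> 0 \<le> euclid n y (mat_app m M x))"

lemma lorentz_positive_iff:
  "lorentz_positive n m M \<longleftrightarrow> (\<forall>x. forward m x \<longrightarrow> forward n (mat_app m M x))"
  unfolding lorentz_positive_def using forward_if_dual forward_pairing_nonneg by blast

text \<open>The vectors \<open>e\<^sub>0 \<plusminus> e\<^sub>i\<close> lie in the cone. This bounds the set of Lorentz-positive matrices with a
  given corner entry.\<close>

lemma lorentz_positive_entries:
  assumes M: "lorentz_positive n m M" and "i \<le> n" "j \<le> m"
  shows "\<bar>M i j\<bar> \<le> M 0 0"
proof -
  define y where "y s = (if i = 0 then coord 0 else (\<lambda>k. coord 0 k + s * coord i k))" for s :: real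
  define x where "x s = (if j = 0 then coord 0 else (\<lambda>k. coord 0 k + s * coord j k))" for s :: real
  have "forward n (y s)" "forward m (x s)" if "s = 1 \<or> s = -1" for s
    using forward_add_coord[of i n s] forward_add_coord[of j m s] forward_coord0 assms that
    by (auto simp: y_def x_def)
  then have pos: "0 \<le> euclid n (y s) (mat_app m M (x t))" if "s = 1 \<or> s = -1" "t = 1 \<or> t = -1" for s t
    using M that by (simp add: lorentz_positive_def)
  have mat_app_x: "mat_app m M (x t) = (\<lambda>k. if j = 0 then M k 0 else M k 0 + t * M k j)" for t
    using mat_app_combination[of m M 1 "coord 0" t "coord j"] assms(3) by (auto simp: x_def mat_app_coord)
  have euclid_y: "euclid n (y s) w = (if i = 0 then w 0 else w 0 + s * w i)" for s w
  proof -
    have "euclid n w (y s) = (if i = 0 then w 0 else w 0 + s * w i)"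
      using euclid_combination[of n w 1 "coord 0" s "coord i"] assms(2) by (auto simp: y_def euclid_coord)
    then show ?thesis by (simp only: euclid_commute[of n w])
  qed
  show ?thesis
    using pos[of 1 1] pos[of 1 "-1"] pos[of "-1" 1] pos[of "-1" "-1"]
    by (auto simp: euclid_y mat_app_x split: if_splits)
qed

section \<open>Extreme Lorentz-positive matrices\<close>

text \<open>The constant \<open>c\<close> must lie above all ratios \<open>q x / j x\<close> with \<open>j x < 0\<close> and below all ratios
  \<open>q y / j y\<close> with \<open>j y > 0\<close>. That the former are at most the latter is a statement about the plane
  spanned by \<open>x\<close> and \<open>y\<close>: it contains two null directions of \<open>j\<close>, on which \<open>q\<close> is nonnegative, and a
  positive combination of these two inequalities is free of the mixed term \<open>q' y x\<close>.\<close>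

lemma S_lemma:
  fixes q j :: "(nat \<Rightarrow> real) \<Rightarrow> real"
  assumes q: "\<And>a b x y. q (\<lambda>i. a * x i + b * y i) = a\<^sup>2 * q x + 2 * a * b * q' x y + b\<^sup>2 * q y"
    and j: "\<And>a b x y. j (\<lambda>i. a * x i + b * y i) = a\<^sup>2 * j x + 2 * a * b * j' x y + b\<^sup>2 * j y"
    and pos: "\<And>x. 0 \<le> j x \<Longrightarrow> 0 \<le> q x" and x0: "0 < j x0"
  shows "\<exists>c\<ge>0. \<forall>x. c * j x \<le> q x"
proof -
  define c where "c = (INF x\<in>{x. 0 < j x}. q x / j x)"
  have bdd: "bdd_below ((\<lambda>x. q x / j x) ` {x. 0 < j x})"
    using pos by (intro bdd_belowI[of _ 0]) auto
  have "0 \<le> c" unfolding c_def using x0 pos by (intro cINF_greatest) auto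
  moreover have "c * j x \<le> q x" for x
  proof -
    consider "0 < j x" | "j x = 0" | "j x < 0" by linarith
    then show ?thesis
    proof cases
      case 1
      then have "c \<le> q x / j x" unfolding c_def using bdd by (intro cINF_lower) auto
      then show ?thesis using 1 by (simp add: pos_le_divide_eq)
    next
      case 2
      then show ?thesis using pos by simp
    next
      case 3
      have "q x / j x \<le> q y / j y" if y: "0 < j y" for y
      proof -
        define J where "J = j' y x"
        define r where "r = sqrt (J\<^sup>2 - j y * j x)"
        have neg: "j y * j x < 0" using y 3 by (simp add: mult_pos_neg)
        then have D: "0 \<le> J\<^sup>2 - j y * j x" by (smt (verit) zero_le_power2)
        then have r2: "r\<^sup>2 = J\<^sup>2 - j y * j x" and r0: "0 \<le> r" by (simp_all add: r_def)
        have "\<bar>J\<bar>\<^sup>2 < r\<^sup>2" using neg by (simp add: r2)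
        then have r: "\<bar>J\<bar> < r" using r0 by (rule power_less_imp_less_base)
        \<comment> \<open>The null directions are \<open>\<alpha> y + (j y) x\<close> with \<open>\<alpha>\<close> a root of \<open>\<alpha>\<^sup>2 + 2 \<alpha> J + j y * j x\<close>.\<close>
        have null: "0 \<le> \<alpha>\<^sup>2 * q y + 2 * \<alpha> * j y * q' y x + (j y)\<^sup>2 * q x"
          if "\<alpha> = - J + r \<or> \<alpha> = - J - r" for \<alpha>
        proof -
          have "(\<alpha> + J)\<^sup>2 = J\<^sup>2 - j y * j x" using that by (auto simp: r2[symmetric])
          then have "\<alpha>\<^sup>2 + 2 * \<alpha> * J + j y * j x = 0" by (simp add: power2_eq_square algebra_simps)
          moreover have "j (\<lambda>i. \<alpha> * y i + j y * x i) = j y * (\<alpha>\<^sup>2 + 2 * \<alpha> * J + j y * j x)"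
            by (simp add: j J_def power2_eq_square algebra_simps)
          ultimately show ?thesis using pos[of "\<lambda>i. \<alpha> * y i + j y * x i"] by (simp add: q)
        qed
        have "0 \<le> (J + r) * ((- J + r)\<^sup>2 * q y + 2 * (- J + r) * j y * q' y x + (j y)\<^sup>2 * q x)
            + (r - J) * ((- J - r)\<^sup>2 * q y + 2 * (- J - r) * j y * q' y x + (j y)\<^sup>2 * q x)"
          by (rule add_nonneg_nonneg; rule mult_nonneg_nonneg; (rule null)?) (use r in auto)
        also have "\<dots> = 2 * r * ((r\<^sup>2 - J\<^sup>2) * q y + (j y)\<^sup>2 * q x)"
          by (simp add: power2_eq_square algebra_simps)
        also have "r\<^sup>2 - J\<^sup>2 = - (j y * j x)" by (simp add: r2)
        also have "2 * r * (- (j y * j x) * q y + (j y)\<^sup>2 * q x) = 2 * r * j y * (j y * q x - j x * q y)"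
          by (simp add: power2_eq_square algebra_simps)
        finally have "0 \<le> (2 * r * j y) * (j y * q x - j x * q y)" .
        moreover have "0 < 2 * r * j y" using r y by (intro mult_pos_pos) auto
        ultimately have "0 \<le> j y * q x - j x * q y" by (meson mult_less_0_iff not_less)
        then show ?thesis using y 3 by (simp add: field_simps)
      qed
      then have "q x / j x \<le> c" unfolding c_def using x0 by (intro cINF_greatest) auto
      then show ?thesis using 3 by (simp add: neg_divide_le_eq)
    qed
  qed
  ultimately show ?thesis by blast
qed

text \<open>The inequality keeps images of cone vectors out of the spacelike region, so only their time
  orientation is in question. It cannot change along the segment from the time axis to a cone
  vector, because all points but the endpoint are strictly timelike.\<close>

lemma lorentz_positive_if_form_le:
  assumes c: "0 < c" and le: "\<And>x. c * minkowski m x x \<le> minkowski n (mat_app m M x) (mat_app m M x)"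
    and M00: "0 < M 0 0"
  shows "lorentz_positive n m M"
  unfolding lorentz_positive_iff
proof (intro allI impI)
  fix x assume x: "forward m x"
  define b where "b = mat_app m M x 0"
  have form: "0 \<le> minkowski n (mat_app m M x) (mat_app m M x)"
    using le[of x] x c by (smt (verit) forward_def mult_nonneg_nonneg)
  have "0 \<le> b"
  proof (rule ccontr)
    assume b: "\<not> 0 \<le> b"
    \<comment> \<open>A timelike combination of the time axis and x whose image has time coordinate 0.\<close>
    define w where "w i = - b * coord 0 i + M 0 0 * x i" for i
    have "minkowski m w w = b\<^sup>2 + 2 * (- b) * M 0 0 * x 0 + (M 0 0)\<^sup>2 * minkowski m x x"
      unfolding w_def minkowski_combination_self by (simp add: minkowski_coord0) (simp add: coord_def)
    moreover have "0 < b\<^sup>2" using b by simp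
    moreover have "0 \<le> 2 * (- b) * M 0 0 * x 0" "0 \<le> (M 0 0)\<^sup>2 * minkowski m x x"
      using b M00 x by (intro mult_nonneg_nonneg; simp add: forward_def)+
    ultimately have "0 < minkowski m w w" by linarith
    then have "0 < minkowski n (mat_app m M w) (mat_app m M w)" using le[of w] c by (smt (verit) mult_pos_pos)
    moreover have "mat_app m M w 0 = 0"
      unfolding w_def mat_app_combination by (simp add: mat_app_coord b_def)
    ultimately have "(\<Sum>i=1..n. (mat_app m M w i)\<^sup>2) < 0" by (simp add: minkowski_def power2_eq_square)
    then show False by (simp add: sum_nonneg leD)
  qed
  then show "forward n (mat_app m M x)" using form by (simp add: forward_def b_def)
qed

text \<open>Extreme rays of the cone of Lorentz-positive matrices, with generators normalised at the corner
  entry, which is positive unless the matrix vanishes.\<close>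

definition extreme_positive :: "nat \<Rightarrow> nat \<Rightarrow> (nat \<Rightarrow> nat \<Rightarrow> real) \<Rightarrow> bool" where
  "extreme_positive n m M \<longleftrightarrow> lorentz_positive n m M \<and> M 0 0 = 1 \<and>
    (\<forall>N. lorentz_positive n m (\<lambda>i j. M i j + N i j) \<longrightarrow> lorentz_positive n m (\<lambda>i j. M i j - N i j) \<longrightarrow>
      (\<exists>r. \<forall>i\<le>n. \<forall>j\<le>m. N i j = r * M i j))"

lemma mat_app_lincomb_mats: "mat_app m (\<lambda>i j. a * M i j + b * N i j) x = (\<lambda>i. a * mat_app m M x i + b * mat_app m N x i)"
  by (rule ext) (simp add: mat_app_def sum.distrib sum_distrib_left algebra_simps)

lemma lorentz_positive_combination:
  assumes "lorentz_positive n m M" "lorentz_positive n m N" "0 \<le> a" "0 \<le> b"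
  shows "lorentz_positive n m (\<lambda>i j. a * M i j + b * N i j)"
  using assms by (simp add: lorentz_positive_def mat_app_lincomb_mats euclid_combination)

text \<open>Subtracting a small multiple of the squared norm makes the linear objective strictly concave, so
  that its minimum over the compact base \<open>M 0 0 = 1\<close> is attained only at extreme points; the multiple
  is small enough to keep the linear part negative there.\<close>

lemma ex_extreme_positive:
  assumes M: "lorentz_positive n m M" and neg: "(\<Sum>i\<le>n. \<Sum>j\<le>m. M i j * s i j) < 0"
  shows "\<exists>E. extreme_positive n m E \<and> (\<Sum>i\<le>n. \<Sum>j\<le>m. E i j * s i j) < 0"
proof -
  define I where "I = {..n} \<times> {..m}"
  define \<sigma> where "\<sigma> F = (\<Sum>x\<in>I. F x * (case x of (i, j) \<Rightarrow> s i j))" for F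
  define \<nu> where "\<nu> F = (\<Sum>x\<in>I. (F x)\<^sup>2)" for F :: "nat \<times> nat \<Rightarrow> real"
  have sigma_eq: "\<sigma> (case_prod E) = (\<Sum>i\<le>n. \<Sum>j\<le>m. E i j * s i j)" for E
    unfolding \<sigma>_def I_def sum.cartesian_product by (intro sum.cong) auto
  define A where "A = {F. lorentz_positive n m (curry F) \<and> F (0, 0) = 1}"
  have abs_le: "\<bar>F x\<bar> \<le> 1" if "F \<in> A" "x \<in> I" for F x
    using lorentz_positive_entries[of n m "curry F" "fst x" "snd x"] that by (auto simp: A_def I_def)
  have finI: "finite I" by (simp add: I_def)
  have M00: "0 < M 0 0"
  proof (rule ccontr)
    assume "\<not> 0 < M 0 0"
    then have "M i j = 0" if "i \<le> n" "j \<le> m" for i j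
      using lorentz_positive_entries[OF M that] by linarith
    then show False using neg by simp
  qed
  define F0 where "F0 = (\<lambda>(i, j). M i j / M 0 0)"
  have F0: "F0 \<in> A"
    using lorentz_positive_combination[OF M M, of "1 / M 0 0" 0] M00
    by (simp add: A_def F0_def curry_def)
  have "\<sigma> F0 = (\<Sum>i\<le>n. \<Sum>j\<le>m. M i j * s i j) / M 0 0"
    unfolding F0_def sigma_eq by (simp add: sum_divide_distrib)
  then have sigma_F0: "\<sigma> F0 < 0" using neg M00 by (simp add: divide_neg_pos)
  \<comment> \<open>On the base the squared norm is at most \<open>card I\<close>, which dictates the size of \<open>\<epsilon>\<close>.\<close>
  define \<epsilon> where "\<epsilon> = - \<sigma> F0 / (real (card I) + 1)"
  have eps: "0 < \<epsilon>" using sigma_F0 by (simp add: \<epsilon>_def divide_neg_pos)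
  define \<phi> where "\<phi> F = \<sigma> F - \<epsilon> * \<nu> F" for F
  have "\<exists>F\<in>A. \<forall>G\<in>A. \<phi> F \<le> \<phi> G"
  proof (rule attains_min_on_closed_bounded[of I F0 A 1])
    fix f :: "nat \<Rightarrow> nat \<times> nat \<Rightarrow> real"
    assume f: "\<And>k. f k \<in> A" and conv: "\<And>x. x \<in> I \<Longrightarrow> convergent (\<lambda>k. f k x)"
    then obtain l where l: "\<And>x. x \<in> I \<Longrightarrow> (\<lambda>k. f k x) \<longlonglongrightarrow> l x"
      unfolding convergent_def by metis
    have "l (0, 0) = 1"
      using LIMSEQ_unique[OF l[of "(0, 0)"], of 1] f by (simp add: I_def A_def)
    moreover have "lorentz_positive n m (curry l)"
      unfolding lorentz_positive_def euclid_mat_app_sum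
    proof (intro allI impI)
      fix x y assume xy: "forward n y" "forward m x"
      have "(\<lambda>k. \<Sum>i\<le>n. \<Sum>j\<le>m. curry (f k) i j * y i * x j)
          \<longlonglongrightarrow> (\<Sum>i\<le>n. \<Sum>j\<le>m. curry l i j * y i * x j)"
        using l by (intro tendsto_intros) (auto simp: I_def)
      moreover have "0 \<le> (\<Sum>i\<le>n. \<Sum>j\<le>m. curry (f k) i j * y i * x j)" for k
        using f[of k] xy by (simp add: A_def lorentz_positive_def euclid_mat_app_sum)
      ultimately show "0 \<le> (\<Sum>i\<le>n. \<Sum>j\<le>m. curry l i j * y i * x j)"
        by (intro LIMSEQ_le_const) auto
    qed
    ultimately show "\<exists>l\<in>A. \<forall>x\<in>I. (\<lambda>k. f k x) \<longlonglongrightarrow> l x" using l by (auto simp: A_def)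
  next
    fix f :: "nat \<Rightarrow> nat \<times> nat \<Rightarrow> real" and l
    assume "\<And>x. x \<in> I \<Longrightarrow> (\<lambda>k. f k x) \<longlonglongrightarrow> l x"
    then show "(\<lambda>k. \<phi> (f k)) \<longlonglongrightarrow> \<phi> l"
      unfolding \<phi>_def \<sigma>_def \<nu>_def by (intro tendsto_intros) auto
  qed (use finI F0 abs_le in auto)
  then obtain F where F: "F \<in> A" and min_F: "\<And>G. G \<in> A \<Longrightarrow> \<phi> F \<le> \<phi> G" by blast
  have nu_F: "\<nu> F \<le> real (card I)"
  proof -
    have "\<nu> F \<le> (\<Sum>x\<in>I. 1)" unfolding \<nu>_def
      using abs_le[OF F] by (intro sum_mono) (simp add: abs_square_le_1)
    then show ?thesis by simp
  qed
  have nu_F0: "0 \<le> \<epsilon> * \<nu> F0" using eps by (simp add: \<nu>_def sum_nonneg)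
  have "\<sigma> F \<le> \<sigma> F0 + \<epsilon> * \<nu> F - \<epsilon> * \<nu> F0" using min_F[OF F0] by (simp add: \<phi>_def)
  also have "\<dots> \<le> \<sigma> F0 + \<epsilon> * real (card I)"
    using mult_left_mono[OF nu_F, of \<epsilon>] nu_F0 eps by linarith
  also have "\<dots> = \<sigma> F0 / (real (card I) + 1)" by (simp add: \<epsilon>_def field_simps)
  also have "\<dots> < 0" using sigma_F0 by (simp add: divide_neg_pos)
  finally have sigma_F: "\<sigma> F < 0" .
  define E where "E = curry F"
  have E: "lorentz_positive n m E" "E 0 0 = 1" using F by (auto simp: A_def E_def)
  have "extreme_positive n m E"
    unfolding extreme_positive_def
  proof (intro conjI allI impI)
    fix N
    assume plus: "lorentz_positive n m (\<lambda>i j. E i j + N i j)"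
      and minus: "lorentz_positive n m (\<lambda>i j. E i j - N i j)"
    have N00: "\<bar>N 0 0\<bar> \<le> 1"
      using lorentz_positive_entries[OF plus, of 0 0] lorentz_positive_entries[OF minus, of 0 0] E by simp
    \<comment> \<open>Correcting \<open>N\<close> by a multiple of \<open>E\<close> gives a perturbation that stays in the base.\<close>
    define d where "d x = (N (fst x) (snd x) - N 0 0 * F x) / 2" for x
    have step: "(\<lambda>x. F x + t * d x) \<in> A" if t: "t = 1 \<or> t = -1" for t
    proof -
      have "lorentz_positive n m (\<lambda>i j. (1 - t * N 0 0) / 2 * E i j + 1 / 2 * (E i j + t * N i j))"
        using t plus minus N00 by (intro lorentz_positive_combination E) auto
      moreover have "(\<lambda>i j. (1 - t * N 0 0) / 2 * E i j + 1 / 2 * (E i j + t * N i j))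
          = curry (\<lambda>x. F x + t * d x)"
        by (intro ext) (simp add: E_def d_def field_simps)
      moreover have "d (0, 0) = 0" using E by (simp add: d_def E_def)
      ultimately show ?thesis using E by (simp add: A_def E_def)
    qed
    have nu: "\<nu> (\<lambda>x. F x + t * d x) = \<nu> F + 2 * t * (\<Sum>x\<in>I. F x * d x) + t\<^sup>2 * \<nu> d" for t
      by (simp add: \<nu>_def sum.distrib sum_distrib_left power2_eq_square algebra_simps)
    have sigma: "\<sigma> (\<lambda>x. F x + t * d x) = \<sigma> F + t * \<sigma> d" for t
      by (simp add: \<sigma>_def sum.distrib sum_distrib_left algebra_simps)
    have "\<phi> (\<lambda>x. F x + 1 * d x) + \<phi> (\<lambda>x. F x + (-1) * d x) = 2 * \<phi> F - 2 * (\<epsilon> * \<nu> d)"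
      unfolding \<phi>_def nu sigma by (simp add: algebra_simps)
    then have "\<epsilon> * \<nu> d \<le> 0" using min_F[OF step[of 1]] min_F[OF step[of "-1"]] by linarith
    then have "\<nu> d \<le> 0" using eps by (simp add: mult_le_0_iff)
    then have "\<nu> d = 0" unfolding \<nu>_def by (intro antisym sum_nonneg) auto
    then have "\<forall>x\<in>I. d x = 0" using finI by (simp add: \<nu>_def sum_nonneg_eq_0_iff)
    then have d0: "d (i, j) = 0" if "i \<le> n" "j \<le> m" for i j using that by (simp add: I_def)
    have "N i j = N 0 0 * E i j" if "i \<le> n" "j \<le> m" for i j
      using d0[OF that] by (simp add: d_def E_def)
    then have "\<forall>i\<le>n. \<forall>j\<le>m. N i j = N 0 0 * E i j" by blast
    then show "\<exists>r. \<forall>i\<le>n. \<forall>j\<le>m. N i j = r * E i j" ..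
  qed (use E in auto)
  moreover have "(\<Sum>i\<le>n. \<Sum>j\<le>m. E i j * s i j) < 0"
    using sigma_F sigma_eq[of E] by (simp add: E_def)
  ultimately show ?thesis by blast
qed

text \<open>Let \<open>Q\<close> be the slack in the inequality given by the S-lemma. If \<open>c > 0\<close> and \<open>Q\<close> is not zero, choose
  \<open>x0\<close> with \<open>Q x0 x0 > 0\<close> and let \<open>z\<close> represent the functional \<open>Q x0\<close>. For the perturbation of \<open>M\<close> by a
  multiple of \<open>y z\<^sup>T\<close> the Lorentz form of the image changes by multiples of \<open>(z\<^sup>T x)\<^sup>2\<close> only, provided that
  \<open>M\<^sup>T J y\<close> is a multiple of \<open>z\<close>, where \<open>J\<close> is the matrix of the Lorentz form; by Cauchy-Schwarz
  for \<open>Q\<close> the slack absorbs this. Such a \<open>y \<noteq> 0\<close> exists by counting: the \<open>n + 1\<close> rows of \<open>M\<close> and \<open>z\<close>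
  are more than \<open>m + 1\<close> vectors in \<open>\<real>\<^bsup>m+1\<^esup>\<close>. This is where \<open>m \<le> n\<close> enters.\<close>

lemma extreme_positive_cases:
  assumes E: "extreme_positive n m M" and "m \<le> n"
  obtains (rank_one) y z where "\<And>i j. i \<le> n \<Longrightarrow> j \<le> m \<Longrightarrow> M i j = y i * z j"
    | (conformal) c where "0 < c" "\<And>x. minkowski n (mat_app m M x) (mat_app m M x) = c * minkowski m x x"
proof -
  have M: "lorentz_positive n m M" and M00: "M 0 0 = 1" using E by (auto simp: extreme_positive_def)
  have "0 \<le> minkowski n (mat_app m M x) (mat_app m M x)" if x: "0 \<le> minkowski m x x" for x
  proof (cases "0 \<le> x 0")
    case True
    then show ?thesis using M x by (auto simp: lorentz_positive_iff forward_def)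
  next
    case False
    have "forward m (\<lambda>i. (-1) * x i + 0 * x i)"
      using False x minkowski_combination_self[of m "-1" x 0 x] by (simp add: forward_def)
    then have "forward n (mat_app m M (\<lambda>i. (-1) * x i + 0 * x i))"
      using M by (simp add: lorentz_positive_iff)
    then show ?thesis
      unfolding mat_app_combination forward_def minkowski_combination_self by simp
  qed
  then obtain c where c: "0 \<le> c" "\<And>x. c * minkowski m x x \<le> minkowski n (mat_app m M x) (mat_app m M x)"
    using S_lemma[of "\<lambda>x. minkowski n (mat_app m M x) (mat_app m M x)" "\<lambda>x y. minkowski n (mat_app m M x) (mat_app m M y)"
        "\<lambda>x. minkowski m x x" "minkowski m" "coord 0"]
    by (auto simp: mat_app_combination minkowski_combination_self minkowski_coord0 coord_def)
  define Q where "Q x y = minkowski n (mat_app m M x) (mat_app m M y) - c * minkowski m x y" for x y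
  consider "c = 0" | "0 < c" "\<forall>x. Q x x = 0" | x0 where "0 < c" "Q x0 x0 \<noteq> 0" using c by force
  then show thesis
  proof cases
    case 1
    have "M i j = M i 0 * M 0 j" if "i \<le> n" "j \<le> m" for i j
    proof -
      \<comment> \<open>The image of M contains no spacelike vector, so its time coordinate determines it.\<close>
      define w where "w = mat_app m M (\<lambda>k. 1 * coord j k + (- M 0 j) * coord 0 k)"
      have w: "w k = M k j - M 0 j * M k 0" for k
        using mat_app_combination[of m M 1 "coord j" "- M 0 j" "coord 0"] that by (simp add: w_def mat_app_coord)
      have "w 0 = 0" by (simp add: w M00)
      moreover have "0 \<le> minkowski n w w" using c 1 unfolding w_def by simp
      ultimately have "(\<Sum>k=1..n. (w k)\<^sup>2) \<le> 0" by (simp add: minkowski_def power2_eq_square)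
      then have "(\<Sum>k=1..n. (w k)\<^sup>2) = 0" by (intro antisym sum_nonneg) auto
      then have "\<forall>k\<in>{1..n}. w k = 0" by (simp add: sum_nonneg_eq_0_iff)
      with \<open>w 0 = 0\<close> that have "w i = 0" by (cases "i = 0") auto
      then show ?thesis by (simp add: w mult.commute)
    qed
    then show thesis by (rule rank_one)
  next
    case 2
    then show thesis by (intro conformal[of c]) (auto simp: Q_def)
  next
    case 3
    have Q_nonneg: "0 \<le> Q x x" for x using c by (simp add: Q_def)
    then have Q0: "0 < Q x0 x0" using 3 by (simp add: less_le)
    define z where "z j = (\<Sum>i\<le>n. reflect (mat_app m M x0) i * M i j) - c * reflect x0 j" for j
    have z: "euclid m z x = Q x0 x" for x
    proof -
      have "euclid m z x = 1 * euclid m x (\<lambda>j. \<Sum>i\<le>n. reflect (mat_app m M x0) i * M i j) + (- c) * euclid m x (reflect x0)"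
        unfolding euclid_combination[symmetric] z_def by (subst euclid_commute) simp
      then show ?thesis
        by (simp add: Q_def minkowski_eq_euclid euclid_mat_app euclid_commute[of m x])
    qed
    have CS: "(euclid m z x)\<^sup>2 / Q x0 x0 \<le> Q x x" for x
    proof -
      have "Q (\<lambda>i. a * x0 i + b * x i) (\<lambda>i. a * x0 i + b * x i) = a\<^sup>2 * Q x0 x0 + 2 * a * b * Q x0 x + b\<^sup>2 * Q x x" for a b
        by (simp add: Q_def mat_app_combination minkowski_combination_self algebra_simps)
      then have "0 \<le> (- Q x0 x / Q x0 x0)\<^sup>2 * Q x0 x0 + 2 * (- Q x0 x / Q x0 x0) * 1 * Q x0 x + 1\<^sup>2 * Q x x"
        using Q_nonneg by metis
      also have "\<dots> = Q x x - (Q x0 x)\<^sup>2 / Q x0 x0"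
        using Q0 by (simp add: power2_eq_square)
      finally show ?thesis by (simp add: z)
    qed
    obtain a where a: "\<exists>k\<le>Suc n. a k \<noteq> 0"
        "\<And>j. j \<le> m \<Longrightarrow> (\<Sum>k\<le>Suc n. a k * (if k \<le> n then M k j else z j)) = 0"
      using linear_relation[of "{..m}" "{..Suc n}" "\<lambda>k j. if k \<le> n then M k j else z j"] \<open>m \<le> n\<close>
      by auto
    define \<kappa> where "\<kappa> = - a (Suc n)"
    have a_rows: "(\<Sum>k\<le>n. a k * M k j) = \<kappa> * z j" if "j \<le> m" for j
      using a(2)[OF that] by (simp add: \<kappa>_def)
    have a_mat_app: "euclid n a (mat_app m M x) = \<kappa> * euclid m z x" for x
      unfolding euclid_mat_app by (simp add: euclid_def a_rows sum_distrib_left mult_ac)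
    have z_nz: "\<exists>j\<le>m. z j \<noteq> 0"
    proof (rule ccontr)
      assume "\<not> ?thesis"
      then have "euclid m z x0 = 0" by (simp add: euclid_def)
      then show False using z Q0 by simp
    qed
    have a_nz: "\<exists>k\<le>n. a k \<noteq> 0"
    proof (rule ccontr)
      assume *: "\<not> ?thesis"
      then have "\<kappa> \<noteq> 0" using a(1) by (auto simp: \<kappa>_def le_Suc_eq)
      then show False using a_rows z_nz * by auto
    qed
    define y where "y = reflect a"
    define K where "K = 2 * \<bar>\<kappa>\<bar> + \<bar>minkowski n y y\<bar> + 1"
    define t where "t = Min {1, 1 / (Q x0 x0 * K), 1 / (2 * (\<bar>y 0 * z 0\<bar> + 1))}"
    have K: "1 \<le> K" by (simp add: K_def)
    have t: "0 < t" "t \<le> 1" "t \<le> 1 / (Q x0 x0 * K)" "t \<le> 1 / (2 * (\<bar>y 0 * z 0\<bar> + 1))"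
      using Q0 K by (auto simp: t_def add_nonneg_pos)
    have "lorentz_positive n m (\<lambda>i j. M i j + s * (t * (y i * z j)))" if s: "s = 1 \<or> s = -1" for s :: real
    proof (rule lorentz_positive_if_form_le[OF \<open>0 < c\<close>])
      have "t * \<bar>y 0 * z 0\<bar> \<le> 1 / (2 * (\<bar>y 0 * z 0\<bar> + 1)) * \<bar>y 0 * z 0\<bar>"
        using t by (intro mult_right_mono) auto
      also have "\<dots> < 1" by (simp add: field_simps add_pos_nonneg)
      finally have "\<bar>t * (y 0 * z 0)\<bar> < 1" using t by (simp add: abs_mult)
      then show "0 < M 0 0 + s * (t * (y 0 * z 0))" using s M00 by auto
    next
      fix x
      let ?Mx = "mat_app m M x" and ?\<zeta> = "euclid m z x"
      let ?N = "\<lambda>i j. M i j + s * (t * (y i * z j))"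
      have mat_app_N: "mat_app m ?N x = (\<lambda>i. 1 * ?Mx i + (s * t * ?\<zeta>) * y i)"
        by (rule ext) (simp add: mat_app_def euclid_def algebra_simps sum.distrib sum_distrib_left)
      have "minkowski n ?Mx y = minkowski n y ?Mx" by (rule minkowski_commute)
      also have "\<dots> = \<kappa> * ?\<zeta>" by (simp add: minkowski_eq_euclid y_def a_mat_app)
      finally have My: "minkowski n ?Mx y = \<kappa> * ?\<zeta>" .
      have s2: "s\<^sup>2 = 1" using s by auto
      have "minkowski n (mat_app m ?N x) (mat_app m ?N x)
          = 1\<^sup>2 * minkowski n ?Mx ?Mx + 2 * 1 * (s * t * ?\<zeta>) * minkowski n ?Mx y + (s * t * ?\<zeta>)\<^sup>2 * minkowski n y y"
        unfolding mat_app_N by (rule minkowski_combination_self)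
      also have "\<dots> = minkowski n ?Mx ?Mx + (2 * s * t * \<kappa> + t\<^sup>2 * minkowski n y y) * ?\<zeta>\<^sup>2"
        unfolding My power_mult_distrib s2 by (simp add: power2_eq_square algebra_simps)
      finally have form: "minkowski n (mat_app m ?N x) (mat_app m ?N x)
          = minkowski n ?Mx ?Mx + (2 * s * t * \<kappa> + t\<^sup>2 * minkowski n y y) * ?\<zeta>\<^sup>2" .
      have "\<bar>2 * s * t * \<kappa>\<bar> = t * (2 * \<bar>\<kappa>\<bar>)" using s t by (auto simp: abs_mult)
      moreover have "\<bar>t\<^sup>2 * minkowski n y y\<bar> \<le> t * \<bar>minkowski n y y\<bar>"
        using t mult_right_mono[OF mult_left_le[of t t], of "\<bar>minkowski n y y\<bar>"]
        by (simp add: abs_mult power2_eq_square)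
      moreover have "t * K = t * (2 * \<bar>\<kappa>\<bar>) + t * \<bar>minkowski n y y\<bar> + t"
        by (simp add: K_def distrib_left)
      ultimately have "\<bar>2 * s * t * \<kappa> + t\<^sup>2 * minkowski n y y\<bar> \<le> t * K"
        using t by linarith
      also have "\<dots> \<le> 1 / (Q x0 x0 * K) * K" using t K by (intro mult_right_mono) auto
      also have "\<dots> = 1 / Q x0 x0" using K by simp
      finally have "- (1 / Q x0 x0) \<le> 2 * s * t * \<kappa> + t\<^sup>2 * minkowski n y y" by linarith
      then have "- (1 / Q x0 x0) * ?\<zeta>\<^sup>2 \<le> (2 * s * t * \<kappa> + t\<^sup>2 * minkowski n y y) * ?\<zeta>\<^sup>2"
        by (intro mult_right_mono) auto
      then show "c * minkowski m x x \<le> minkowski n (mat_app m (\<lambda>i j. M i j + s * (t * (y i * z j))) x)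
          (mat_app m (\<lambda>i j. M i j + s * (t * (y i * z j))) x)"
        unfolding form using CS[of x] by (simp add: Q_def)
    qed
    from this[of 1] this[of "-1"] obtain r where r: "\<And>i j. i \<le> n \<Longrightarrow> j \<le> m \<Longrightarrow> t * (y i * z j) = r * M i j"
      using E unfolding extreme_positive_def by (auto dest!: spec[of _ "\<lambda>i j. t * (y i * z j)"])
    obtain i0 j0 where "i0 \<le> n" "a i0 \<noteq> 0" "j0 \<le> m" "z j0 \<noteq> 0" using a_nz z_nz by blast
    then have "r \<noteq> 0" using r[of i0 j0] t by (auto simp: y_def reflect_def split: if_splits)
    then have "M i j = (t / r * y i) * z j" if "i \<le> n" "j \<le> m" for i j
      using r[OF that] by (simp add: field_simps)
    then show thesis by (rule rank_one)
  qed
qed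

section \<open>Null vectors\<close>

text \<open>For \<open>u \<in> \<real>\<^sup>n\<close>, indexed from 0, this is the inner product of the parts \<open>u'\<close> with indices \<open>1..n-1\<close>.
  Coordinate \<open>i\<close> of \<open>u'\<close> corresponds to coordinate \<open>i + 1\<close> in \<open>\<real>\<^bsup>n+1\<^esup>\<close>, which explains the shift below.\<close>

definition tail_inner :: "nat \<Rightarrow> (nat \<Rightarrow> real) \<Rightarrow> (nat \<Rightarrow> real) \<Rightarrow> real" where
  "tail_inner n x y = (\<Sum>i\<in>{1..<n}. x i * y i)"

definition tail :: "(nat \<Rightarrow> real) \<Rightarrow> nat \<Rightarrow> real" where
  "tail x i = x (i + 1)"

text \<open>The image of \<open>u u\<^sup>T\<close> under the adjoint of \<open>W\<^bsub>n+1\<^esub>\<close>. Projectively it is the inverse stereographic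
  projection of \<open>u' / u\<^sub>0\<close>.\<close>

definition null_vec :: "nat \<Rightarrow> (nat \<Rightarrow> real) \<Rightarrow> nat \<Rightarrow> real" where
  "null_vec n u k = (if k = 0 then (u 0)\<^sup>2 + tail_inner n u u else if k = 1 then (u 0)\<^sup>2 - tail_inner n u u else 2 * u 0 * u (k - 1))"

lemma sum_lessThan_split_0: "1 \<le> n \<Longrightarrow> (\<Sum>k<n. f k) = f 0 + (\<Sum>k\<in>{1..<n}. f k)" for f :: "nat \<Rightarrow> real"
  using sum.atLeast_Suc_lessThan[of 0 n f] by (simp add: atLeast0LessThan)

lemma sum_split_1: "1 \<le> n \<Longrightarrow> (\<Sum>i=1..n. f i) = f 1 + (\<Sum>i\<in>{1..<n}. f (i + 1))" for f :: "nat \<Rightarrow> real"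
  using sum.atLeast_Suc_atMost[of 1 n f] sum.shift_bounds_Suc_ivl[of f 1 n] by (simp add: atLeastLessThanSuc_atLeastAtMost)

lemma tail_inner_commute: "tail_inner n x y = tail_inner n y x" by (simp add: tail_inner_def mult.commute)
lemma tail_inner_self_nonneg: "0 \<le> tail_inner n x x" by (simp add: tail_inner_def sum_nonneg)

lemma tail_inner_combination: "tail_inner n z (\<lambda>i. a * x i + b * y i) = a * tail_inner n z x + b * tail_inner n z y"
  by (simp add: tail_inner_def sum.distrib sum_distrib_left algebra_simps)

lemma tail_inner_combination_self: "tail_inner n (\<lambda>i. a * x i + b * y i) (\<lambda>i. a * x i + b * y i)
    = a\<^sup>2 * tail_inner n x x + 2 * a * b * tail_inner n x y + b\<^sup>2 * tail_inner n y y"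
  by (simp add: tail_inner_combination tail_inner_commute[of n "\<lambda>i. a * x i + b * y i"] tail_inner_commute[of n y x]
      power2_eq_square algebra_simps)

lemma minkowski_split: "1 \<le> n \<Longrightarrow> minkowski n x y = x 0 * y 0 - x 1 * y 1 - tail_inner n (tail x) (tail y)"
  unfolding minkowski_def by (subst sum_split_1) (simp_all add: tail_inner_def tail_def)

lemma euclid_split: "1 \<le> n \<Longrightarrow> euclid n x y = x 0 * y 0 + x 1 * y 1 + tail_inner n (tail x) (tail y)"
  unfolding euclid_eq by (subst sum_split_1) (simp_all add: tail_inner_def tail_def)

lemma tail_inner_tail_null_vec: "tail_inner n (tail (null_vec n u)) y = 2 * u 0 * tail_inner n u y"
  by (simp add: tail_inner_def tail_def null_vec_def sum_distrib_left mult_ac)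

lemma euclid_null_vec:
  "1 \<le> n \<Longrightarrow> euclid n (null_vec n u) g = (g 0 + g 1) * (u 0)\<^sup>2 + 2 * u 0 * tail_inner n (tail g) u + (g 0 - g 1) * tail_inner n u u"
  by (simp add: euclid_split tail_inner_tail_null_vec tail_inner_commute[of n u "tail g"]) (simp add: null_vec_def algebra_simps)

lemma lagrange_identity:
  "tail_inner n x x * tail_inner n y y - (tail_inner n x y)\<^sup>2 = (\<Sum>i\<in>{1..<n}. \<Sum>j\<in>{1..<n}. (x i * y j - x j * y i)\<^sup>2) / 2"
proof -
  have "(x i * y j - x j * y i)\<^sup>2
      = (x i * x i) * (y j * y j) + (y i * y i) * (x j * x j) - 2 * ((x i * y i) * (x j * y j))" for i j
    by (simp add: power2_eq_square algebra_simps)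
  then have "(\<Sum>i\<in>{1..<n}. \<Sum>j\<in>{1..<n}. (x i * y j - x j * y i)\<^sup>2)
      = tail_inner n x x * tail_inner n y y + tail_inner n y y * tail_inner n x x - 2 * (tail_inner n x y * tail_inner n x y)"
    by (simp only: tail_inner_def sum.distrib sum_subtractf sum_distrib_left[symmetric] sum_distrib_right[symmetric])
  then show ?thesis by (simp add: power2_eq_square)
qed

section \<open>Sums of squares of bilinear forms\<close>

text \<open>Matrices of size \<open>nm\<close> are treated as arrays with row index \<open>(i, a)\<close> and column index \<open>(j, b)\<close>, and
  \<open>form4\<close> is their inner product.\<close>

definition form4 where
  "form4 n m Q t = (\<Sum>i<n. \<Sum>a<m. \<Sum>j<n. \<Sum>b<m. Q i a j b * t i a j b :: real)" for n m :: nat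

definition psd4 :: "nat \<Rightarrow> nat \<Rightarrow> (nat \<Rightarrow> nat \<Rightarrow> nat \<Rightarrow> nat \<Rightarrow> real) \<Rightarrow> bool" where
  "psd4 n m t \<longleftrightarrow> (\<forall>G. 0 \<le> form4 n m (\<lambda>i a j b. G i a * G j b) t)"

text \<open>The biquadratic form \<open>p\<close> has a positive semidefinite Gram matrix \<open>Q\<close>. Positive semidefiniteness of
  \<open>Q\<close> is stated by duality, in the form in which it is needed.\<close>

definition gram_psd :: "nat \<Rightarrow> nat \<Rightarrow> ((nat \<Rightarrow> real) \<Rightarrow> (nat \<Rightarrow> real) \<Rightarrow> real) \<Rightarrow> bool" where
  "gram_psd n m p \<longleftrightarrow> (\<exists>Q. (\<forall>u v. p u v = form4 n m Q (\<lambda>i a j b. u i * v a * u j * v b)) \<and>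
      (\<forall>t. psd4 n m t \<longrightarrow> 0 \<le> form4 n m Q t))"

lemma form4_add: "form4 n m (\<lambda>i a j b. Q i a j b + R i a j b) t = form4 n m Q t + form4 n m R t"
  by (simp add: form4_def algebra_simps sum.distrib)

lemma form4_scale: "form4 n m (\<lambda>i a j b. r * Q i a j b) t = r * form4 n m Q t"
  by (simp add: form4_def sum_distrib_left mult_ac)

lemma gram_psd_add: "gram_psd n m p \<Longrightarrow> gram_psd n m q \<Longrightarrow> gram_psd n m (\<lambda>u v. p u v + q u v)"
  unfolding gram_psd_def
  by (elim exE conjE, rule_tac x = "\<lambda>i a j b. Q i a j b + Qa i a j b" in exI) (simp add: form4_add)

lemma gram_psd_scale: "0 \<le> r \<Longrightarrow> gram_psd n m p \<Longrightarrow> gram_psd n m (\<lambda>u v. r * p u v)"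
  unfolding gram_psd_def
  by (elim exE conjE, rule_tac x = "\<lambda>i a j b. r * Q i a j b" in exI) (simp add: form4_scale)

lemma gram_psd_0: "gram_psd n m (\<lambda>u v. 0)"
  unfolding gram_psd_def by (rule exI[of _ "\<lambda>i a j b. 0"]) (simp add: form4_def)

lemma gram_psd_sum: "(\<And>k. k \<in> K \<Longrightarrow> gram_psd n m (p k)) \<Longrightarrow> gram_psd n m (\<lambda>u v. \<Sum>k\<in>K. p k u v)"
proof (induction K rule: infinite_finite_induct)
  case (insert k K)
  then show ?case by (simp add: gram_psd_add)
qed (simp_all add: gram_psd_0)

definition linear_form :: "nat \<Rightarrow> ((nat \<Rightarrow> real) \<Rightarrow> real) \<Rightarrow> bool" where
  "linear_form n l \<longleftrightarrow> (\<exists>c. \<forall>u. l u = (\<Sum>i<n. c i * u i))"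

definition bilinear_form :: "nat \<Rightarrow> nat \<Rightarrow> ((nat \<Rightarrow> real) \<Rightarrow> (nat \<Rightarrow> real) \<Rightarrow> real) \<Rightarrow> bool" where
  "bilinear_form n m g \<longleftrightarrow> (\<exists>G. \<forall>u v. g u v = (\<Sum>i<n. \<Sum>a<m. G i a * u i * v a))"

lemma gram_psd_square:
  assumes "bilinear_form n m g"
  shows "gram_psd n m (\<lambda>u v. (g u v)\<^sup>2)"
proof -
  obtain G where G: "\<And>u v. g u v = (\<Sum>i<n. \<Sum>a<m. G i a * u i * v a)"
    using assms by (auto simp: bilinear_form_def)
  have "(g u v)\<^sup>2 = form4 n m (\<lambda>i a j b. G i a * G j b) (\<lambda>i a j b. u i * v a * u j * v b)" for u v
  proof -
    have "(g u v)\<^sup>2 = (\<Sum>i<n. \<Sum>a<m. G i a * u i * v a * (\<Sum>j<n. \<Sum>b<m. G j b * u j * v b))"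
      unfolding G power2_eq_square by (simp only: sum_distrib_right)
    also have "\<dots> = (\<Sum>i<n. \<Sum>a<m. \<Sum>j<n. \<Sum>b<m. G i a * u i * v a * (G j b * u j * v b))"
      by (simp only: sum_distrib_left)
    also have "\<dots> = form4 n m (\<lambda>i a j b. G i a * G j b) (\<lambda>i a j b. u i * v a * u j * v b)"
      unfolding form4_def by (intro sum.cong refl) simp
    finally show ?thesis .
  qed
  then show ?thesis by (auto simp: gram_psd_def psd4_def)
qed

lemma linear_form_var:
  assumes "i < n"
  shows "linear_form n (\<lambda>u. u i)"
proof -
  have "u i = (\<Sum>k<n. coord i k * u k)" for u :: "nat \<Rightarrow> real"
    using sum_mult_indicator[of "{..<n}" u i] assms by (simp only: mult.commute) simp
  then show ?thesis unfolding linear_form_def by blast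
qed

lemma linear_form_add:
  assumes "linear_form n l" "linear_form n k"
  shows "linear_form n (\<lambda>u. l u + k u)"
proof -
  obtain c d where "\<And>u. l u = (\<Sum>i<n. c i * u i)" "\<And>u. k u = (\<Sum>i<n. d i * u i)"
    using assms unfolding linear_form_def by blast
  then have "l u + k u = (\<Sum>i<n. (c i + d i) * u i)" for u by (simp add: distrib_right sum.distrib)
  then show ?thesis unfolding linear_form_def by (intro exI[of _ "\<lambda>i. c i + d i"]) blast
qed

lemma linear_form_scale:
  assumes "linear_form n l"
  shows "linear_form n (\<lambda>u. r * l u)"
proof -
  obtain c where "\<And>u. l u = (\<Sum>i<n. c i * u i)"
    using assms unfolding linear_form_def by blast
  then have "r * l u = (\<Sum>i<n. (r * c i) * u i)" for u by (simp add: sum_distrib_left mult.assoc)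
  then show ?thesis unfolding linear_form_def by (intro exI[of _ "\<lambda>i. r * c i"]) blast
qed

lemma linear_form_diff: "linear_form n l \<Longrightarrow> linear_form n k \<Longrightarrow> linear_form n (\<lambda>u. l u - k u)"
  using linear_form_add[of n l "\<lambda>u. (-1) * k u"] linear_form_scale[of n k "-1"] by simp

lemma linear_form_0: "linear_form n (\<lambda>u. 0)"
  unfolding linear_form_def by (rule exI[of _ "\<lambda>i. 0"]) simp

lemma linear_form_sum: "(\<And>k. k \<in> K \<Longrightarrow> linear_form n (l k)) \<Longrightarrow> linear_form n (\<lambda>u. \<Sum>k\<in>K. l k u)"
proof (induction K rule: infinite_finite_induct)
  case (insert k K)
  then show ?case by (simp add: linear_form_add)
qed (simp_all add: linear_form_0)

lemma bilinear_form_mult: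
  assumes "linear_form n l" "linear_form m k"
  shows "bilinear_form n m (\<lambda>u v. l u * k v)"
proof -
  obtain c d where cd: "\<And>u. l u = (\<Sum>i<n. c i * u i)" "\<And>v. k v = (\<Sum>a<m. d a * v a)"
    using assms unfolding linear_form_def by blast
  have "l u * k v = (\<Sum>i<n. \<Sum>a<m. (c i * d a) * u i * v a)" for u v
    unfolding cd sum_product by (intro sum.cong refl) simp
  then show ?thesis unfolding bilinear_form_def by (intro exI[of _ "\<lambda>i a. c i * d a"]) blast
qed

lemma bilinear_form_add:
  assumes "bilinear_form n m l" "bilinear_form n m k"
  shows "bilinear_form n m (\<lambda>u v. l u v + k u v)"
proof -
  obtain G H where "\<And>u v. l u v = (\<Sum>i<n. \<Sum>a<m. G i a * u i * v a)"
      "\<And>u v. k u v = (\<Sum>i<n. \<Sum>a<m. H i a * u i * v a)"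
    using assms unfolding bilinear_form_def by blast
  then have "l u v + k u v = (\<Sum>i<n. \<Sum>a<m. (G i a + H i a) * u i * v a)" for u v
    by (simp add: distrib_right sum.distrib)
  then show ?thesis unfolding bilinear_form_def by (intro exI[of _ "\<lambda>i a. G i a + H i a"]) blast
qed

lemma bilinear_form_scale:
  assumes "bilinear_form n m l"
  shows "bilinear_form n m (\<lambda>u v. r * l u v)"
proof -
  obtain G where "\<And>u v. l u v = (\<Sum>i<n. \<Sum>a<m. G i a * u i * v a)"
    using assms unfolding bilinear_form_def by blast
  then have "r * l u v = (\<Sum>i<n. \<Sum>a<m. (r * G i a) * u i * v a)" for u v
    by (simp add: sum_distrib_left mult.assoc)
  then show ?thesis unfolding bilinear_form_def by (intro exI[of _ "\<lambda>i a. r * G i a"]) blast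
qed

lemma bilinear_form_diff: "bilinear_form n m l \<Longrightarrow> bilinear_form n m k \<Longrightarrow> bilinear_form n m (\<lambda>u v. l u v - k u v)"
  using bilinear_form_add[of n m l "\<lambda>u v. (-1) * k u v"] bilinear_form_scale[of n m k "-1"] by simp

lemma bilinear_form_0: "bilinear_form n m (\<lambda>u v. 0)"
  unfolding bilinear_form_def by (rule exI[of _ "\<lambda>i a. 0"]) simp

lemma bilinear_form_sum: "(\<And>k. k \<in> K \<Longrightarrow> bilinear_form n m (l k)) \<Longrightarrow> bilinear_form n m (\<lambda>u v. \<Sum>k\<in>K. l k u v)"
proof (induction K rule: infinite_finite_induct)
  case (insert k K)
  then show ?case by (simp add: bilinear_form_add)
qed (simp_all add: bilinear_form_0)

text \<open>Let \<open>\<xi> = (1, -1, 0)\<close> be the null vector of the point at infinity, \<open>c = M \<xi>\<close> and \<open>g v = M (N v)\<close>, so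
  that \<open>N(u)\<^sup>T g v\<close> is to be written as a sum of squares. Since \<open>N v = v\<^sub>0 \<eta> + |v'|\<^sup>2 \<xi>\<close> with \<open>\<eta>\<close> linear
  in \<open>v\<close>, also \<open>g v = v\<^sub>0 q v + |v'|\<^sup>2 c\<close> with \<open>q\<close> linear. The conformality relations for \<open>\<xi>\<close> and \<open>\<eta>\<close>
  determine all Lorentz products of \<open>c\<close> and \<open>q v\<close>.

  If \<open>A = c 0 - c 1\<close> vanishes, infinity is mapped to infinity, the map is a similarity, and the form is
  a positive multiple of a squared Euclidean distance, hence a sum of squares as it stands. Otherwise \<open>c\<close> represents a finite
  point. Translating it to the origin and scaling by \<open>A\<close> replaces \<open>u'\<close> by \<open>w u\<close>, and in place of the spatial part of \<open>q v\<close>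
  there appears a vector \<open>h v\<close>, linear in \<open>v\<close>, such that with \<open>\<mu> = 4 l A\<close>
    \<open>\<mu> A\<^sup>2 N(u)\<^sup>T g v = (\<mu> u\<^sub>0 v\<^sub>0 + w \<cdot> h)\<^sup>2 + |w|\<^sup>2 |h|\<^sup>2 - (w \<cdot> h)\<^sup>2\<close>.
  The last two terms are a sum of squares of \<open>w\<^sub>i h\<^sub>j - w\<^sub>j h\<^sub>i\<close> by the Lagrange identity.\<close>

lemma gram_psd_conformal:
  assumes n: "1 \<le> n" and m: "1 \<le> m" and pos: "lorentz_positive n m M" and l: "0 < l"
    and conf: "\<And>x. minkowski n (mat_app m M x) (mat_app m M x) = l * minkowski m x x"
  shows "gram_psd n m (\<lambda>u v. euclid n (null_vec n u) (mat_app m M (null_vec m v)))"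
proof -
  have polar: "minkowski n (mat_app m M x) (mat_app m M y) = l * minkowski m x y" for x y
    using conf[of "\<lambda>i. 1 * x i + 1 * y i"] unfolding mat_app_combination minkowski_combination_self conf
    by (simp add: algebra_simps)
  define \<xi> where "\<xi> i = coord 0 i + (-1) * coord 1 i" for i
  define c where "c = mat_app m M \<xi>"
  define A where "A = c 0 - c 1"
  define C where "C = c 0 + c 1"
  define \<eta> where "\<eta> v k = (if k \<le> 1 then v 0 else 2 * v (k - 1))" for v :: "nat \<Rightarrow> real" and k :: nat
  define q where "q v = mat_app m M (\<eta> v)" for v
  define g where "g v = mat_app m M (null_vec m v)" for v
  have "forward m \<xi>" using forward_add_coord[of 1 m "-1"] m by (simp add: \<xi>_def[abs_def])
  then have "forward n c" using pos by (simp add: lorentz_positive_iff c_def)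
  then have c0: "0 \<le> c 0" "(\<Sum>i=1..n. (c i)\<^sup>2) \<le> (c 0)\<^sup>2" by (auto simp: forward_iff)
  have "(c 1)\<^sup>2 \<le> (\<Sum>i=1..n. (c i)\<^sup>2)" using n by (intro member_le_sum) auto
  then have "(c 1)\<^sup>2 \<le> (c 0)\<^sup>2" using c0 by linarith
  then have "\<bar>c 1\<bar> \<le> c 0" using c0(1) by (simp add: abs_le_square_iff[symmetric])
  then have A0: "0 \<le> A" and C0: "0 \<le> C" by (auto simp: A_def C_def)
  have xi_simps: "\<xi> 0 = 1" "\<xi> (Suc 0) = -1" by (simp_all add: \<xi>_def coord_def)
  have tail_inner_xi: "tail_inner k (tail \<xi>) x = 0" "tail_inner k x (tail \<xi>) = 0" for k x
    by (simp_all add: tail_inner_def tail_def \<xi>_def coord_def)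
  have cc: "tail_inner n (tail c) (tail c) = A * C"
    using polar[of \<xi> \<xi>] n m by (simp add: c_def[symmetric] minkowski_split xi_simps tail_inner_xi A_def C_def algebra_simps)
  have qc: "(q v 0 + q v 1) * A + (q v 0 - q v 1) * C - 2 * tail_inner n (tail (q v)) (tail c) = 4 * l * v 0" for v
    using polar[of "\<eta> v" \<xi>] n m
    by (simp add: c_def[symmetric] q_def[symmetric] minkowski_split xi_simps tail_inner_xi A_def C_def)
      (simp add: \<eta>_def algebra_simps)
  have tail_eta: "tail_inner m (tail (\<eta> v)) (tail (\<eta> v)) = 4 * tail_inner m v v" for v
    by (simp add: tail_inner_def tail_def \<eta>_def sum_distrib_left mult_ac)
  have qq: "tail_inner n (tail (q v)) (tail (q v)) = (q v 0 + q v 1) * (q v 0 - q v 1) + 4 * l * tail_inner m v v" for v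
    using polar[of "\<eta> v" "\<eta> v"] n m
    by (simp add: q_def[symmetric] minkowski_split tail_eta) (simp add: \<eta>_def algebra_simps)
  have g: "g v i = v 0 * q v i + tail_inner m v v * c i" for v i
  proof -
    have "null_vec m v = (\<lambda>k. v 0 * \<eta> v k + tail_inner m v v * \<xi> k)"
      by (rule ext) (simp add: null_vec_def \<eta>_def \<xi>_def coord_def power2_eq_square)
    then show ?thesis by (simp add: g_def q_def c_def mat_app_combination)
  qed
  have lin_q: "linear_form m (\<lambda>v. q v i)" for i
  proof -
    have "linear_form m (\<lambda>v. M i j * \<eta> v j)" if "j \<le> m" for j
      using that m by (cases "j \<le> 1") (auto simp: \<eta>_def intro!: linear_form_scale linear_form_var)
    then show ?thesis unfolding q_def mat_app_def by (intro linear_form_sum) auto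
  qed
  have form: "euclid n (null_vec n u) (g v)
      = (g v 0 + g v 1) * (u 0)\<^sup>2 + 2 * u 0 * tail_inner n (tail (g v)) u + (g v 0 - g v 1) * tail_inner n u u" for u v
    by (rule euclid_null_vec[OF n])
  have tail_g: "tail (g v) = (\<lambda>i. v 0 * tail (q v) i + tail_inner m v v * tail c i)" for v
    by (rule ext) (simp add: tail_def g)
  show ?thesis
  proof (cases "A = 0")
    case True
    have "(\<Sum>i\<in>{1..<n}. (tail c i)\<^sup>2) = 0" using cc True by (simp add: tail_inner_def power2_eq_square)
    then have c': "tail c i = 0" if "i \<in> {1..<n}" for i
      using that by (simp add: sum_nonneg_eq_0_iff)
    then have ipc: "tail_inner n x (tail c) = 0" "tail_inner n (tail c) x = 0" for x by (simp_all add: tail_inner_def)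
    have Cq: "(q v 0 - q v 1) * C = 4 * l * v 0" for v using qc[of v] True by (simp add: ipc)
    from this[of "coord 0"] have C: "0 < C" using C0 l by (auto simp: coord_def less_le)
    have eq: "euclid n (null_vec n u) (g v)
        = 1 / (4 * l * C) * (\<Sum>i\<in>{1..<n}. (C * u 0 * tail (q v) i + 4 * l * v 0 * u i)\<^sup>2)" for u v
    proof -
      have gu: "tail_inner n (tail (g v)) u = v 0 * tail_inner n (tail (q v)) u"
        unfolding tail_g tail_inner_commute[of n _ u] tail_inner_combination by (simp add: ipc)
      have "C * tail_inner n (tail (q v)) (tail (q v))
          = (q v 0 + q v 1) * ((q v 0 - q v 1) * C) + 4 * l * tail_inner m v v * C"
        unfolding qq by (simp add: algebra_simps)
      then have Cqq: "C * tail_inner n (tail (q v)) (tail (q v))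
          = (4 * l * v 0) * (q v 0 + q v 1) + 4 * l * tail_inner m v v * C"
        unfolding Cq by (simp add: mult.commute)
      have gd: "g v 0 - g v 1 = v 0 * (q v 0 - q v 1)"
        using True by (simp add: g A_def algebra_simps)
      have gs: "g v 0 + g v 1 = v 0 * (q v 0 + q v 1) + tail_inner m v v * C"
        by (simp add: g C_def algebra_simps)
      have "4 * l * C * euclid n (null_vec n u) (g v)
          = C * (u 0)\<^sup>2 * ((4 * l * v 0) * (q v 0 + q v 1) + 4 * l * tail_inner m v v * C)
            + 2 * u 0 * C * (4 * l * v 0) * tail_inner n (tail (q v)) u
            + (4 * l * v 0) * ((q v 0 - q v 1) * C) * tail_inner n u u"
        unfolding form gu gd gs by (simp add: power2_eq_square algebra_simps)
      also have "\<dots> = C * (u 0)\<^sup>2 * (C * tail_inner n (tail (q v)) (tail (q v)))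
            + 2 * u 0 * C * (4 * l * v 0) * tail_inner n (tail (q v)) u
            + (4 * l * v 0)\<^sup>2 * tail_inner n u u"
        unfolding Cqq Cq by (simp add: power2_eq_square algebra_simps)
      also have "\<dots> = tail_inner n (\<lambda>i. C * u 0 * tail (q v) i + 4 * l * v 0 * u i) (\<lambda>i. C * u 0 * tail (q v) i + 4 * l * v 0 * u i)"
        by (simp add: tail_inner_combination_self power2_eq_square)
      finally have *: "4 * l * C * euclid n (null_vec n u) (g v) = \<dots>" .
      have "euclid n (null_vec n u) (g v) = 1 / (4 * l * C) * (4 * l * C * euclid n (null_vec n u) (g v))"
        using C l by simp
      then show ?thesis unfolding * by (simp add: tail_inner_def power2_eq_square)
    qed
    have "gram_psd n m (\<lambda>u v. 1 / (4 * l * C) * (\<Sum>i\<in>{1..<n}. (C * u 0 * tail (q v) i + 4 * l * v 0 * u i)\<^sup>2))"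
    proof (intro gram_psd_scale gram_psd_sum gram_psd_square)
      fix i assume i: "i \<in> {1..<n}"
      have "bilinear_form n m (\<lambda>u v. C * (u 0 * tail (q v) i) + 4 * l * (u i * v 0))"
        unfolding tail_def using i m
        by (intro bilinear_form_add bilinear_form_scale bilinear_form_mult linear_form_var lin_q) auto
      then show "bilinear_form n m (\<lambda>u v. C * u 0 * tail (q v) i + 4 * l * v 0 * u i)"
        by (simp add: mult_ac)
    qed (use C l in auto)
    then show ?thesis unfolding g_def[symmetric] eq .
  next
    case False
    then have A: "0 < A" using A0 by simp
    define h where "h v i = A * tail (q v) i + (- (q v 0 - q v 1)) * tail c i" for v i
    define w where "w u i = A * u i + u 0 * tail c i" for u :: "nat \<Rightarrow> real" and i
    have g_diff: "g v 0 - g v 1 = v 0 * (q v 0 - q v 1) + tail_inner m v v * A" for v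
      by (simp add: g A_def algebra_simps)
    have hh: "tail_inner n (h v) (h v) = 4 * l * A * (g v 0 - g v 1)" for v
    proof -
      define s d X where "s = q v 0 + q v 1" and "d = q v 0 - q v 1" and "X = tail_inner n (tail (q v)) (tail c)"
      have X: "2 * X = s * A + d * C - 4 * l * v 0" using qc[of v] by (simp add: s_def d_def X_def)
      have "tail_inner n (h v) (h v) = A\<^sup>2 * (s * d + 4 * l * tail_inner m v v) - A * d * (2 * X) + d\<^sup>2 * (A * C)"
        unfolding h_def tail_inner_combination_self cc qq
        by (simp add: s_def d_def X_def power2_eq_square algebra_simps)
      also have "\<dots> = 4 * l * A * (v 0 * d + tail_inner m v v * A)"
        unfolding X by (simp add: power2_eq_square algebra_simps)
      finally show ?thesis unfolding g_diff d_def .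
    qed
    have gc: "(g v 0 + g v 1) * A + (g v 0 - g v 1) * C - 2 * tail_inner n (tail (g v)) (tail c) = 4 * l * (v 0)\<^sup>2" for v
    proof -
      have "tail_inner n (tail (g v)) (tail c) = v 0 * tail_inner n (tail (q v)) (tail c) + tail_inner m v v * (A * C)"
      proof -
        have "tail_inner n (tail c) (tail (g v)) = v 0 * tail_inner n (tail c) (tail (q v)) + tail_inner m v v * (A * C)"
          unfolding tail_g tail_inner_combination cc ..
        then show ?thesis by (metis tail_inner_commute)
      qed
      then have "(g v 0 + g v 1) * A + (g v 0 - g v 1) * C - 2 * tail_inner n (tail (g v)) (tail c)
          = v 0 * ((q v 0 + q v 1) * A + (q v 0 - q v 1) * C - 2 * tail_inner n (tail (q v)) (tail c))"
        by (simp add: g A_def C_def algebra_simps)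
      then show ?thesis unfolding qc by (simp add: power2_eq_square)
    qed
    have wh: "u 0 * v 0 * tail_inner n (w u) (h v)
        = A\<^sup>2 * u 0 * tail_inner n (tail (g v)) u - A * u 0 * (g v 0 - g v 1) * tail_inner n (tail c) u
          + A * (u 0)\<^sup>2 * tail_inner n (tail (g v)) (tail c) - (u 0)\<^sup>2 * (g v 0 - g v 1) * (A * C)" for u v
    proof -
      have "(\<lambda>i. A * tail (g v) i + (- (g v 0 - g v 1)) * tail c i) = (\<lambda>i. v 0 * h v i + 0 * h v i)"
        unfolding tail_g h_def g_diff by (rule ext) (simp add: algebra_simps)
      then have "v 0 * tail_inner n (w u) (h v) = tail_inner n (w u) (\<lambda>i. A * tail (g v) i + (- (g v 0 - g v 1)) * tail c i)"
        by (simp only: tail_inner_combination)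
      also have "\<dots> = A * (A * tail_inner n (tail (g v)) u + u 0 * tail_inner n (tail (g v)) (tail c))
          - (g v 0 - g v 1) * (A * tail_inner n (tail c) u + u 0 * (A * C))"
        unfolding tail_inner_combination unfolding tail_inner_commute[of n "w u"] unfolding w_def tail_inner_combination cc
        by (simp add: algebra_simps)
      finally have *: "v 0 * tail_inner n (w u) (h v) = \<dots>" .
      have "u 0 * v 0 * tail_inner n (w u) (h v) = u 0 * (v 0 * tail_inner n (w u) (h v))" by simp
      then show ?thesis unfolding * by (simp add: power2_eq_square algebra_simps)
    qed
    have eq: "euclid n (null_vec n u) (g v) = 1 / (4 * l * A ^ 3) * ((4 * l * A * (u 0 * v 0) + tail_inner n (w u) (h v))\<^sup>2
        + 1 / 2 * (\<Sum>i\<in>{1..<n}. \<Sum>j\<in>{1..<n}. (w u i * h v j - w u j * h v i)\<^sup>2))" for u v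
    proof -
      define G \<mu> where "G = g v 0 - g v 1" and "\<mu> = 4 * l * A"
      have ww: "tail_inner n (w u) (w u) = A\<^sup>2 * tail_inner n u u + 2 * A * u 0 * tail_inner n (tail c) u + (u 0)\<^sup>2 * (A * C)"
        unfolding w_def tail_inner_combination_self cc by (simp add: tail_inner_commute)
      have "A\<^sup>2 * euclid n (null_vec n u) (g v)
          = (u 0)\<^sup>2 * A * ((g v 0 + g v 1) * A + G * C - 2 * tail_inner n (tail (g v)) (tail c))
            + 2 * (u 0 * v 0 * tail_inner n (w u) (h v)) + G * tail_inner n (w u) (w u)"
        unfolding form wh ww G_def[symmetric] by (simp add: power2_eq_square algebra_simps)
      also have "\<dots> = \<mu> * (u 0 * v 0)\<^sup>2 + 2 * (u 0 * v 0) * tail_inner n (w u) (h v) + G * tail_inner n (w u) (w u)"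
        unfolding G_def gc by (simp add: \<mu>_def power2_eq_square algebra_simps)
      finally have *: "A\<^sup>2 * euclid n (null_vec n u) (g v) = \<dots>" .
      have "\<mu> * (A\<^sup>2 * euclid n (null_vec n u) (g v))
          = (\<mu> * (u 0 * v 0) + tail_inner n (w u) (h v))\<^sup>2 + (tail_inner n (w u) (w u) * tail_inner n (h v) (h v) - (tail_inner n (w u) (h v))\<^sup>2)"
        unfolding * hh G_def \<mu>_def[symmetric] by (simp add: power2_eq_square algebra_simps)
      then have *: "\<mu> * (A\<^sup>2 * euclid n (null_vec n u) (g v)) = (\<mu> * (u 0 * v 0) + tail_inner n (w u) (h v))\<^sup>2
          + 1 / 2 * (\<Sum>i\<in>{1..<n}. \<Sum>j\<in>{1..<n}. (w u i * h v j - w u j * h v i)\<^sup>2)"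
        unfolding lagrange_identity by simp
      have "euclid n (null_vec n u) (g v) = 1 / (\<mu> * A\<^sup>2) * (\<mu> * (A\<^sup>2 * euclid n (null_vec n u) (g v)))"
        using A l by (simp add: \<mu>_def)
      also have "\<mu> * A\<^sup>2 = 4 * l * A ^ 3" by (simp add: \<mu>_def power2_eq_square power3_eq_cube)
      finally show ?thesis unfolding * unfolding \<mu>_def .
    qed
    have lin_w: "linear_form n (\<lambda>u. w u i)" if "i \<in> {1..<n}" for i
      using linear_form_add[OF linear_form_scale[of n "\<lambda>u. u i" A] linear_form_scale[of n "\<lambda>u. u 0" "tail c i"]]
        that by (simp add: w_def linear_form_var mult.commute)
    have lin_h: "linear_form m (\<lambda>v. h v i)" for i
      using linear_form_add[OF linear_form_scale[of m "\<lambda>v. q v (i + 1)" A]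
          linear_form_scale[OF linear_form_diff[of m "\<lambda>v. q v 1" "\<lambda>v. q v 0"], of "tail c i"]]
      by (simp add: h_def lin_q tail_def mult.commute)
    have main: "gram_psd n m (\<lambda>u v. (4 * l * A * (u 0 * v 0) + tail_inner n (w u) (h v))\<^sup>2)"
    proof (rule gram_psd_square, rule bilinear_form_add)
      show "bilinear_form n m (\<lambda>u v. 4 * l * A * (u 0 * v 0))"
        using n m by (intro bilinear_form_scale[of n m "\<lambda>u v. u 0 * v 0"] bilinear_form_mult linear_form_var) auto
      show "bilinear_form n m (\<lambda>u v. tail_inner n (w u) (h v))"
        unfolding tail_inner_def by (rule bilinear_form_sum, rule bilinear_form_mult[OF lin_w lin_h])
    qed
    have minor: "gram_psd n m (\<lambda>u v. (w u i * h v j - w u j * h v i)\<^sup>2)" if "i \<in> {1..<n}" "j \<in> {1..<n}" for i j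
      by (rule gram_psd_square, rule bilinear_form_diff)
        (rule bilinear_form_mult[OF lin_w[OF that(1)] lin_h], rule bilinear_form_mult[OF lin_w[OF that(2)] lin_h])
    have "gram_psd n m (\<lambda>u v. \<Sum>i\<in>{1..<n}. \<Sum>j\<in>{1..<n}. (w u i * h v j - w u j * h v i)\<^sup>2)"
      using minor by (intro gram_psd_sum)
    then have "gram_psd n m (\<lambda>u v. 1 / (4 * l * A ^ 3) * ((4 * l * A * (u 0 * v 0) + tail_inner n (w u) (h v))\<^sup>2
        + 1 / 2 * (\<Sum>i\<in>{1..<n}. \<Sum>j\<in>{1..<n}. (w u i * h v j - w u j * h v i)\<^sup>2)))"
      using A l by (intro gram_psd_scale gram_psd_add[OF main]) auto
    then show ?thesis unfolding g_def[symmetric] eq .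
  qed
qed

lemma psd4_nonneg_sum_square: "psd4 n m t \<Longrightarrow> 0 \<le> form4 n m (\<lambda>i a j b. G i a * G j b) t"
  by (simp add: psd4_def)

text \<open>Completing the square in \<open>u'\<close>: the form has matrix \<open>W(y)\<close>, which is positive semidefinite with a
  multiple of the identity as lower block.\<close>

lemma forward_pairing_sum_of_squares:
  assumes n: "1 \<le> n" and y: "forward n y"
  shows "\<exists>w l. (\<forall>k<n. 0 \<le> w k \<and> linear_form n (l k)) \<and> (\<forall>u. euclid n (null_vec n u) y = (\<Sum>k<n. w k * (l k u)\<^sup>2))"
proof -
  define A where "A = y 0 - y 1"
  define C where "C = y 0 + y 1"
  have form: "euclid n (null_vec n u) y = C * (u 0)\<^sup>2 + 2 * u 0 * tail_inner n (tail y) u + A * tail_inner n u u" for u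
    unfolding A_def C_def by (rule euclid_null_vec[OF n])
  have AC: "tail_inner n (tail y) (tail y) \<le> A * C" and y0: "0 \<le> y 0"
    using y n by (auto simp: forward_def minkowski_split A_def C_def algebra_simps)
  have "0 \<le> A * C" using AC tail_inner_self_nonneg[of n "tail y"] by linarith
  then have A0: "0 \<le> A" and C0: "0 \<le> C"
    using y0 unfolding A_def C_def zero_le_mult_iff by linarith+
  note split = sum_lessThan_split_0[OF n]
  show ?thesis
  proof (cases "A = 0")
    case True
    have "tail_inner n (tail y) (tail y) = 0" using AC True tail_inner_self_nonneg[of n "tail y"] by simp
    then have "(\<Sum>i\<in>{1..<n}. (tail y i)\<^sup>2) = 0" by (simp add: tail_inner_def power2_eq_square)
    then have "tail y i = 0" if "i \<in> {1..<n}" for i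
      using that by (simp add: sum_nonneg_eq_0_iff)
    then have "euclid n (null_vec n u) y = C * (u 0)\<^sup>2" for u
      unfolding form by (simp add: tail_inner_def True)
    then show ?thesis
      using n C0 by (intro exI[of _ "\<lambda>k. if k = 0 then C else 0"] exI[of _ "\<lambda>k u. u 0"])
        (auto simp: split linear_form_var)
  next
    case False
    then have A: "0 < A" using A0 by simp
    define w where "w k = (if k = 0 then (A * C - tail_inner n (tail y) (tail y)) / A else 1 / A)" for k :: nat
    define l where "l k u = (if k = 0 then u 0 else A * u k + u 0 * tail y k)" for k and u :: "nat \<Rightarrow> real"
    have "euclid n (null_vec n u) y = (\<Sum>k<n. w k * (l k u)\<^sup>2)" for u
    proof -
      have "(\<Sum>k<n. w k * (l k u)\<^sup>2)
          = (A * C - tail_inner n (tail y) (tail y)) / A * (u 0)\<^sup>2 + (\<Sum>k\<in>{1..<n}. 1 / A * (A * u k + u 0 * tail y k)\<^sup>2)"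
        by (simp add: split w_def l_def)
      also have "(\<Sum>k\<in>{1..<n}. 1 / A * (A * u k + u 0 * tail y k)\<^sup>2)
          = 1 / A * tail_inner n (\<lambda>k. A * u k + u 0 * tail y k) (\<lambda>k. A * u k + u 0 * tail y k)"
        by (simp add: tail_inner_def sum_distrib_left power2_eq_square)
      also have "\<dots> = 1 / A * (A\<^sup>2 * tail_inner n u u + 2 * A * u 0 * tail_inner n (tail y) u + (u 0)\<^sup>2 * tail_inner n (tail y) (tail y))"
        unfolding tail_inner_combination_self by (simp add: tail_inner_commute[of n u "tail y"])
      finally have *: "(\<Sum>k<n. w k * (l k u)\<^sup>2) = (A * C - tail_inner n (tail y) (tail y)) / A * (u 0)\<^sup>2
          + 1 / A * (A\<^sup>2 * tail_inner n u u + 2 * A * u 0 * tail_inner n (tail y) u + (u 0)\<^sup>2 * tail_inner n (tail y) (tail y))" .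
      show ?thesis unfolding form * using A by (simp add: field_simps power2_eq_square)
    qed
    moreover have "linear_form n (l k)" if "k < n" for k
    proof -
      have "linear_form n (\<lambda>u. A * u k + tail y k * u 0)"
        using that n by (intro linear_form_add linear_form_scale linear_form_var) auto
      moreover have "linear_form n (\<lambda>u. u 0)" using n by (intro linear_form_var) auto
      ultimately show ?thesis by (cases "k = 0") (simp_all add: l_def[abs_def] mult.commute)
    qed
    moreover have "0 \<le> w k" for k using A AC by (simp add: w_def)
    ultimately show ?thesis by (intro exI[of _ w] exI[of _ l]) auto
  qed
qed

text \<open>The product of two squares of linear forms is the square of a bilinear form.\<close>

lemma gram_psd_rank_one:
  assumes n: "1 \<le> n" and m: "1 \<le> m" and y: "forward n y" and z: "forward m z"
  shows "gram_psd n m (\<lambda>u v. euclid n (null_vec n u) y * euclid m (null_vec m v) z)"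
proof -
  obtain w l where l: "\<And>k. k < n \<Longrightarrow> 0 \<le> w k" "\<And>k. k < n \<Longrightarrow> linear_form n (l k)"
      "\<And>u. euclid n (null_vec n u) y = (\<Sum>k<n. w k * (l k u)\<^sup>2)"
    using forward_pairing_sum_of_squares[OF n y] by blast
  obtain w' l' where l': "\<And>k. k < m \<Longrightarrow> 0 \<le> w' k" "\<And>k. k < m \<Longrightarrow> linear_form m (l' k)"
      "\<And>u. euclid m (null_vec m u) z = (\<Sum>k<m. w' k * (l' k u)\<^sup>2)"
    using forward_pairing_sum_of_squares[OF m z] by blast
  have eq: "euclid n (null_vec n u) y * euclid m (null_vec m v) z
      = (\<Sum>k<n. \<Sum>k'<m. (w k * w' k') * (l k u * l' k' v)\<^sup>2)" for u v
    unfolding l l' sum_product by (simp add: power_mult_distrib mult_ac)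
  show ?thesis unfolding eq
    by (intro gram_psd_sum gram_psd_scale gram_psd_square bilinear_form_mult) (use l l' in auto)
qed

lemma gram_psd_extreme_positive:
  assumes n: "1 \<le> n" and m: "1 \<le> m" "m \<le> n" and E: "extreme_positive n m M"
  shows "gram_psd n m (\<lambda>u v. euclid n (null_vec n u) (mat_app m M (null_vec m v)))"
proof -
  have M: "lorentz_positive n m M" and M00: "M 0 0 = 1" using E by (auto simp: extreme_positive_def)
  show ?thesis
    using E \<open>m \<le> n\<close>
  proof (cases rule: extreme_positive_cases)
    case (rank_one y z)
    have "mat_app m M x i = y i * euclid m z x" if "i \<le> n" for x i
      using rank_one that by (simp add: mat_app_def euclid_def sum_distrib_left mult_ac)
    then have pair: "euclid n a (mat_app m M x) = euclid n a y * euclid m x z" for a x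
      by (simp add: euclid_def[of n] sum_distrib_left mult_ac euclid_commute[of m x])
    have yz: "y 0 * z 0 = 1" using rank_one M00 by simp
    \<comment> \<open>The factors of \<open>M\<close> lie in the cones up to a common sign; scaling by \<open>z 0\<close> and \<open>y 0\<close> fixes it.\<close>
    define y' where "y' = (\<lambda>i. z 0 * y i + 0 * y i)"
    define z' where "z' = (\<lambda>i. y 0 * z i + 0 * z i)"
    have "forward n y'" "forward m z'"
    proof (safe intro!: forward_if_dual)
      fix a assume "forward n a"
      then have "0 \<le> euclid n a (mat_app m M (coord 0))" using M forward_coord0 by (simp add: lorentz_positive_def)
      then show "0 \<le> euclid n a y'"
        unfolding y'_def euclid_combination by (simp add: pair euclid_commute[of m "coord 0"] euclid_coord mult.commute)
    next
      fix x assume "forward m x"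
      then have "0 \<le> euclid n (coord 0) (mat_app m M x)" using M forward_coord0 by (simp add: lorentz_positive_def)
      then show "0 \<le> euclid m x z'"
        unfolding z'_def euclid_combination by (simp add: pair euclid_commute[of n "coord 0"] euclid_coord)
    qed
    then have "gram_psd n m (\<lambda>u v. euclid n (null_vec n u) y' * euclid m (null_vec m v) z')"
      by (intro gram_psd_rank_one n m)
    moreover have "euclid n a y' * euclid m x z' = euclid n a (mat_app m M x)" for a x
    proof -
      have "euclid n a y' * euclid m x z' = (y 0 * z 0) * (euclid n a y * euclid m x z)"
        unfolding y'_def z'_def euclid_combination by simp
      then show ?thesis by (simp add: yz pair)
    qed
    ultimately show ?thesis by simp
  next
    case (conformal c)
    then show ?thesis using gram_psd_conformal[OF n m(1) M] by blast
  qed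
qed

section \<open>Block-symmetric arrays\<close>

lemma sum4_swap_outer:
  "(\<Sum>i<n. \<Sum>a<m. \<Sum>j<n. \<Sum>b<m. f i a j b) = (\<Sum>i<n. \<Sum>a<m. \<Sum>j<n. \<Sum>b<m. f j a i b)"
  for f :: "nat \<Rightarrow> nat \<Rightarrow> nat \<Rightarrow> nat \<Rightarrow> real"
proof -
  have "(\<Sum>i<n. \<Sum>a<m. \<Sum>j<n. \<Sum>b<m. f i a j b) = (\<Sum>a<m. \<Sum>i<n. \<Sum>j<n. \<Sum>b<m. f i a j b)"
    by (rule sum.swap)
  also have "\<dots> = (\<Sum>a<m. \<Sum>j<n. \<Sum>i<n. \<Sum>b<m. f i a j b)"
    by (rule sum.cong[OF refl], rule sum.swap)
  also have "\<dots> = (\<Sum>j<n. \<Sum>a<m. \<Sum>i<n. \<Sum>b<m. f i a j b)"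
    by (rule sum.swap)
  finally show ?thesis .
qed

lemma sum4_swap_inner:
  "(\<Sum>i<n. \<Sum>a<m. \<Sum>j<n. \<Sum>b<m. f i a j b) = (\<Sum>i<n. \<Sum>a<m. \<Sum>j<n. \<Sum>b<m. f i b j a)"
  for f :: "nat \<Rightarrow> nat \<Rightarrow> nat \<Rightarrow> nat \<Rightarrow> real"
proof -
  have "(\<Sum>a<m. \<Sum>j<n. \<Sum>b<m. f i a j b) = (\<Sum>a<m. \<Sum>j<n. \<Sum>b<m. f i b j a)" for i
  proof -
    have "(\<Sum>a<m. \<Sum>j<n. \<Sum>b<m. f i a j b) = (\<Sum>j<n. \<Sum>a<m. \<Sum>b<m. f i a j b)"
      by (rule sum.swap)
    also have "\<dots> = (\<Sum>j<n. \<Sum>b<m. \<Sum>a<m. f i a j b)"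
      by (rule sum.cong[OF refl], rule sum.swap)
    also have "\<dots> = (\<Sum>b<m. \<Sum>j<n. \<Sum>a<m. f i a j b)"
      by (rule sum.swap)
    finally show ?thesis .
  qed
  then show ?thesis by simp
qed

text \<open>Invariance under transposition and under partial transposition.\<close>

definition block_symmetric :: "nat \<Rightarrow> nat \<Rightarrow> (nat \<Rightarrow> nat \<Rightarrow> nat \<Rightarrow> nat \<Rightarrow> real) \<Rightarrow> bool" where
  "block_symmetric n m t \<longleftrightarrow> (\<forall>i<n. \<forall>a<m. \<forall>j<n. \<forall>b<m. t i a j b = t j b i a \<and> t i a j b = t j a i b)"

lemma block_symmetricD:
  assumes t: "block_symmetric n m t" and "i < n" "a < m" "j < n" "b < m"
  shows "t j b i a = t i a j b" "t j a i b = t i a j b" "t i b j a = t i a j b"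
proof -
  have t: "t i a j b = t j b i a" "t i a j b = t j a i b" if "i < n" "a < m" "j < n" "b < m" for i a j b
    using t that unfolding block_symmetric_def by blast+
  show "t j b i a = t i a j b" using t(1)[of i a j b] assms by simp
  show "t j a i b = t i a j b" using t(2)[of i a j b] assms by simp
  show "t i b j a = t i a j b" using t(2)[of i a j b] t(1)[of j a i b] assms by simp
qed

lemma form4_unit:
  assumes "i < n" "a < m" "j < n" "b < m"
  shows "form4 n m Q (\<lambda>i' a' j' b'. coord i i' * coord a a' * coord j j' * coord b b') = Q i a j b"
proof -
  have "form4 n m Q (\<lambda>i' a' j' b'. coord i i' * coord a a' * coord j j' * coord b b')
      = (\<Sum>i'<n. (\<Sum>a'<m. (\<Sum>j'<n. (\<Sum>b'<m. Q i' a' j' b' * coord b b') * coord j j') * coord a a') * coord i i')"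
    by (simp add: form4_def sum_distrib_left sum_distrib_right mult_ac)
  also have "\<dots> = Q i a j b" using assms by (simp add: sum_mult_indicator)
  finally show ?thesis .
qed

lemma form4_add_right: "form4 n m Q (\<lambda>i a j b. s i a j b + t i a j b) = form4 n m Q s + form4 n m Q t"
  by (simp add: form4_def algebra_simps sum.distrib)

lemma form4_scale_right: "form4 n m Q (\<lambda>i a j b. r * s i a j b) = r * form4 n m Q s"
  by (simp add: form4_def sum_distrib_left mult_ac)

lemma form4_cong: "(\<And>i a j b. i < n \<Longrightarrow> a < m \<Longrightarrow> j < n \<Longrightarrow> b < m \<Longrightarrow> Q i a j b * s i a j b = R i a j b * t i a j b) \<Longrightarrow>
    form4 n m Q s = form4 n m R t"
  unfolding form4_def by (intro sum.cong refl) auto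

text \<open>Polarisation: a biquadratic form that vanishes identically has coefficients whose symmetrisation
  in \<open>i, j\<close> and in \<open>a, b\<close> is zero, and a block-symmetric \<open>t\<close> sees only this symmetrisation.\<close>

lemma form4_eq_0_if_biquadratic_eq_0:
  assumes zero: "\<And>u v. form4 n m R (\<lambda>i a j b. u i * v a * u j * v b) = 0"
    and t: "block_symmetric n m t"
  shows "form4 n m R t = 0"
proof -
  define F where "F u v u' v' = form4 n m R (\<lambda>i a j b. u i * v a * u' j * v' b)" for u v u' v'
  have add1: "F (\<lambda>i. u i + w i) v u' v' = F u v u' v' + F w v u' v'" for u w v u' v'
    unfolding F_def form4_add_right[symmetric] by (simp add: algebra_simps)
  have add2: "F u v (\<lambda>i. u' i + w i) v' = F u v u' v' + F u v w v'" for u w v u' v'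
    unfolding F_def form4_add_right[symmetric] by (simp add: algebra_simps)
  have add3: "F u (\<lambda>i. v i + w i) u' v' = F u v u' v' + F u w u' v'" for u w v u' v'
    unfolding F_def form4_add_right[symmetric] by (simp add: algebra_simps)
  have add4: "F u v u' (\<lambda>i. v' i + w i) = F u v u' v' + F u v u' w" for u w v u' v'
    unfolding F_def form4_add_right[symmetric] by (simp add: algebra_simps)
  have diag: "F u v u v = 0" for u v using zero by (simp add: F_def)
  have half: "F u v u' v + F u' v u v = 0" for u u' v
    using diag[of "\<lambda>i. u i + u' i" v] by (simp add: add1 add2 diag)
  have full: "F u v u' v' + F u' v u v' + F u v' u' v + F u' v' u v = 0" for u u' v v'
    using half[of u "\<lambda>i. v i + v' i" u'] half[of u v u'] half[of u v' u']
    by (simp add: add3 add4)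
  have sym: "R i a j b + R j a i b + R i b j a + R j b i a = 0"
    if "i < n" "a < m" "j < n" "b < m" for i a j b
    using full[of "coord i" "coord a" "coord j" "coord b"] that by (simp add: F_def form4_unit)
  note t1 = block_symmetricD[OF t]
  have "form4 n m R t = form4 n m (\<lambda>i a j b. R j a i b) t"
    unfolding form4_def by (subst sum4_swap_outer) (intro sum.cong refl, simp add: t1)
  moreover have "form4 n m R t = form4 n m (\<lambda>i a j b. R i b j a) t"
    unfolding form4_def by (subst sum4_swap_inner) (intro sum.cong refl, simp add: t1)
  moreover have "form4 n m (\<lambda>i a j b. R j a i b) t = form4 n m (\<lambda>i a j b. R j b i a) t"
    unfolding form4_def by (subst sum4_swap_inner) (intro sum.cong refl, simp add: t1)
  ultimately have "4 * form4 n m R t = form4 n m (\<lambda>i a j b. R i a j b + R j a i b + R i b j a + R j b i a) t"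
    by (simp add: form4_add)
  also have "\<dots> = 0" unfolding form4_def by (intro sum.neutral ballI) (simp add: sym)
  finally show ?thesis by simp
qed

text \<open>Entry \<open>(i, j)\<close> of \<open>W\<^sub>r(e\<^sub>k)\<close>, which does not depend on \<open>r\<close>.\<close>

definition W_coeff :: "nat \<Rightarrow> nat \<Rightarrow> nat \<Rightarrow> real" where
  "W_coeff k i j = (if i = 0 \<and> j = 0 then coord k 0 + coord k 1
     else if i = j then coord k 0 - coord k 1
     else if i = 0 then coord k (j + 1)
     else if j = 0 then coord k (i + 1) else 0)"

definition W_adj4 :: "nat \<Rightarrow> nat \<Rightarrow> (nat \<Rightarrow> nat \<Rightarrow> nat \<Rightarrow> nat \<Rightarrow> real) \<Rightarrow> nat \<Rightarrow> nat \<Rightarrow> real" where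
  "W_adj4 n m t k l = form4 n m (\<lambda>i a j b. W_coeff k i j * W_coeff l a b) t"

lemma W_coeff_quadratic: "1 \<le> n \<Longrightarrow> k \<le> n \<Longrightarrow> (\<Sum>i<n. \<Sum>j<n. W_coeff k i j * (u i * u j)) = null_vec n u k"
proof -
  assume n: "1 \<le> n" and k: "k \<le> n"
  note split = sum_lessThan_split_0[OF n]
  have col: "(\<Sum>j\<in>{1..<n}. W_coeff k 0 j * (u 0 * u j)) = (if 2 \<le> k then u 0 * u (k - 1) else 0)"
  proof -
    have "(\<Sum>j\<in>{1..<n}. W_coeff k 0 j * (u 0 * u j)) = (\<Sum>j\<in>{1..<n}. if j = k - 1 then (if 2 \<le> k then u 0 * u j else 0) else 0)"
      by (intro sum.cong refl) (auto simp: W_coeff_def coord_def)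
    also have "\<dots> = (if 2 \<le> k then u 0 * u (k - 1) else 0)" using k by auto
    finally show ?thesis .
  qed
  have row: "(\<Sum>i\<in>{1..<n}. W_coeff k i 0 * (u i * u 0)) = (\<Sum>i\<in>{1..<n}. W_coeff k 0 i * (u 0 * u i))"
    by (intro sum.cong refl) (auto simp: W_coeff_def)
  have diag: "(\<Sum>j\<in>{1..<n}. W_coeff k i j * (u i * u j)) = (coord k 0 - coord k 1) * (u i * u i)" if "i \<in> {1..<n}" for i
  proof -
    have "(\<Sum>j\<in>{1..<n}. W_coeff k i j * (u i * u j)) = (\<Sum>j\<in>{1..<n}. if j = i then (coord k 0 - coord k 1) * (u i * u j) else 0)"
      using that by (intro sum.cong refl) (auto simp: W_coeff_def)
    then show ?thesis using that by simp
  qed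
  have diag_sum: "(\<Sum>i\<in>{1..<n}. \<Sum>j\<in>{1..<n}. W_coeff k i j * (u i * u j)) = (coord k 0 - coord k 1) * tail_inner n u u"
    unfolding tail_inner_def sum_distrib_left by (intro sum.cong[OF refl] diag)
  have "(\<Sum>i<n. \<Sum>j<n. W_coeff k i j * (u i * u j))
     = (coord k 0 + coord k 1) * (u 0 * u 0) + 2 * (\<Sum>j\<in>{1..<n}. W_coeff k 0 j * (u 0 * u j))
       + (\<Sum>i\<in>{1..<n}. \<Sum>j\<in>{1..<n}. W_coeff k i j * (u i * u j))"
    unfolding split sum.distrib row by (simp add: W_coeff_def)
  also have "\<dots> = null_vec n u k"
    unfolding col diag_sum using k by (auto simp: null_vec_def coord_def power2_eq_square)
  finally show ?thesis .
qed

lemma W_adj4_pure: "1 \<le> n \<Longrightarrow> 1 \<le> m \<Longrightarrow> k \<le> n \<Longrightarrow> l \<le> m \<Longrightarrow>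
    W_adj4 n m (\<lambda>i a j b. u i * v a * u j * v b) k l = null_vec n u k * null_vec m v l"
proof -
  assume *: "1 \<le> n" "1 \<le> m" "k \<le> n" "l \<le> m"
  have "null_vec n u k * null_vec m v l = (\<Sum>i<n. \<Sum>j<n. \<Sum>a<m. \<Sum>b<m. W_coeff k i j * (u i * u j) * (W_coeff l a b * (v a * v b)))"
    unfolding W_coeff_quadratic[OF *(1,3), symmetric] W_coeff_quadratic[OF *(2,4), symmetric]
    by (simp only: sum_distrib_right) (simp only: sum_distrib_left)
  also have "\<dots> = (\<Sum>i<n. \<Sum>a<m. \<Sum>j<n. \<Sum>b<m. W_coeff k i j * (u i * u j) * (W_coeff l a b * (v a * v b)))"
    by (rule sum.cong[OF refl], rule sum.swap)
  also have "\<dots> = W_adj4 n m (\<lambda>i a j b. u i * v a * u j * v b) k l"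
    by (simp add: W_adj4_def form4_def mult_ac)
  finally show ?thesis ..
qed

lemma form4_sum_left: "form4 n m (\<lambda>i a j b. \<Sum>k\<in>K. Q k i a j b) t = (\<Sum>k\<in>K. form4 n m (Q k) t)"
proof (induction K rule: infinite_finite_induct)
  case (insert k K)
  then show ?case by (simp add: form4_add)
qed (simp_all add: form4_def)

lemma pairing_W_adj4: "(\<Sum>k\<le>n. \<Sum>l\<le>m. M k l * W_adj4 n m t k l)
    = form4 n m (\<lambda>i a j b. \<Sum>k\<le>n. \<Sum>l\<le>m. M k l * (W_coeff k i j * W_coeff l a b)) t"
  by (simp add: form4_sum_left form4_scale W_adj4_def)

text \<open>\<open>W(M)\<close> and the Gram matrix have the same biquadratic form, so they pair equally with \<open>t\<close>.\<close>

lemma pairing_W_adj4_nonneg_if_gram_psd: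
  assumes n: "1 \<le> n" and m: "1 \<le> m"
    and gram_psd: "gram_psd n m (\<lambda>u v. euclid n (null_vec n u) (mat_app m M (null_vec m v)))"
    and t: "psd4 n m t" "block_symmetric n m t"
  shows "0 \<le> (\<Sum>k\<le>n. \<Sum>l\<le>m. M k l * W_adj4 n m t k l)"
proof -
  obtain Q where Q: "\<And>u v. euclid n (null_vec n u) (mat_app m M (null_vec m v)) = form4 n m Q (\<lambda>i a j b. u i * v a * u j * v b)"
      "0 \<le> form4 n m Q t" using gram_psd t(1) by (auto simp: gram_psd_def)
  let ?W = "\<lambda>i a j b. \<Sum>k\<le>n. \<Sum>l\<le>m. M k l * (W_coeff k i j * W_coeff l a b)"
  have W: "form4 n m ?W (\<lambda>i a j b. u i * v a * u j * v b) = euclid n (null_vec n u) (mat_app m M (null_vec m v))" for u v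
    unfolding pairing_W_adj4[symmetric] euclid_mat_app_sum
    by (intro sum.cong refl) (simp add: W_adj4_pure[OF n m])
  have "form4 n m (\<lambda>i a j b. ?W i a j b + (-1) * Q i a j b) t = 0"
    by (rule form4_eq_0_if_biquadratic_eq_0[OF _ t(2)]) (simp only: form4_add form4_scale W Q)
  then show ?thesis using Q(2) unfolding form4_add form4_scale pairing_W_adj4 by simp
qed

lemma form4_transpose: "form4 m n (\<lambda>a i b j. Q i a j b) (\<lambda>a i b j. t i a j b) = form4 n m Q t"
proof -
  have "form4 m n (\<lambda>a i b j. Q i a j b) (\<lambda>a i b j. t i a j b) = (\<Sum>a<m. \<Sum>i<n. \<Sum>b<m. \<Sum>j<n. Q i a j b * t i a j b)"
    by (simp add: form4_def)
  also have "\<dots> = (\<Sum>i<n. \<Sum>a<m. \<Sum>b<m. \<Sum>j<n. Q i a j b * t i a j b)" by (rule sum.swap)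
  also have "\<dots> = form4 n m Q t" unfolding form4_def
    by (rule sum.cong[OF refl], rule sum.cong[OF refl], rule sum.swap)
  finally show ?thesis .
qed

lemma psd4_transpose: "psd4 n m t \<Longrightarrow> psd4 m n (\<lambda>a i b j. t i a j b)"
  unfolding psd4_def
proof (intro allI)
  fix G :: "nat \<Rightarrow> nat \<Rightarrow> real"
  assume "\<forall>G. 0 \<le> form4 n m (\<lambda>i a j b. G i a * G j b) t"
  then have "0 \<le> form4 n m (\<lambda>i a j b. G a i * G b j) t" by (rule spec[of _ "\<lambda>i a. G a i"])
  then show "0 \<le> form4 m n (\<lambda>i a j b. G i a * G j b) (\<lambda>a i b j. t i a j b)"
    using form4_transpose[of m n "\<lambda>i a j b. G a i * G b j" t] by simp
qed

lemma W_adj4_transpose: "W_adj4 m n (\<lambda>a i b j. t i a j b) l k = W_adj4 n m t k l"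
  using form4_transpose[of m n "\<lambda>i a j b. W_coeff k i j * W_coeff l a b" t] by (simp add: W_adj4_def mult.commute)

lemma lorentz_positive_transpose: "lorentz_positive n m M \<Longrightarrow> lorentz_positive m n (\<lambda>j i. M i j)"
  unfolding lorentz_positive_def euclid_mat_app_sum
proof (intro allI impI)
  fix x y
  assume *: "\<forall>x y. forward n y \<longrightarrow> forward m x \<longrightarrow> 0 \<le> (\<Sum>i\<le>n. \<Sum>j\<le>m. M i j * y i * x j)"
    and "forward m y" "forward n x"
  then have "0 \<le> (\<Sum>i\<le>n. \<Sum>j\<le>m. M i j * x i * y j)" by blast
  also have "\<dots> = (\<Sum>j\<le>m. \<Sum>i\<le>n. M i j * y j * x i)" by (subst sum.swap) (simp add: mult_ac)
  finally show "0 \<le> (\<Sum>j\<le>m. \<Sum>i\<le>n. M i j * y j * x i)" .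
qed

text \<open>A Lorentz-positive matrix with negative pairing could be replaced by an extreme one. Transposition
  exchanges the roles of \<open>n\<close> and \<open>m\<close>.\<close>

lemma pairing_W_adj4_nonneg:
  assumes "1 \<le> n" "1 \<le> m" "lorentz_positive n m M" "psd4 n m t" "block_symmetric n m t"
  shows "0 \<le> (\<Sum>k\<le>n. \<Sum>l\<le>m. M k l * W_adj4 n m t k l)"
proof -
  have le: "0 \<le> (\<Sum>k\<le>n. \<Sum>l\<le>m. M k l * W_adj4 n m t k l)"
    if m: "1 \<le> m" "m \<le> n" and M: "lorentz_positive n m M"
      and t: "psd4 n m t" "block_symmetric n m t" for n m M t
  proof (rule ccontr)
    assume "\<not> ?thesis"
    then obtain E where E: "extreme_positive n m E" "(\<Sum>k\<le>n. \<Sum>l\<le>m. E k l * W_adj4 n m t k l) < 0"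
      using ex_extreme_positive[OF M, of "W_adj4 n m t"] by auto
    have n: "1 \<le> n" using m by simp
    show False
      using pairing_W_adj4_nonneg_if_gram_psd[OF n m(1) gram_psd_extreme_positive[OF n m E(1)] t] E(2) by simp
  qed
  show ?thesis
  proof (cases "m \<le> n")
    case True
    then show ?thesis using le assms by blast
  next
    case False
    have block: "block_symmetric m n (\<lambda>a i b j. t i a j b)"
      unfolding block_symmetric_def
      by (intro allI impI conjI block_symmetricD(1)[OF assms(5)] block_symmetricD(3)[OF assms(5)])
    have "0 \<le> (\<Sum>l\<le>m. \<Sum>k\<le>n. M k l * W_adj4 m n (\<lambda>a i b j. t i a j b) l k)"
      by (rule le) (use False assms block in \<open>auto intro: lorentz_positive_transpose psd4_transpose\<close>)
    then have "0 \<le> (\<Sum>l\<le>m. \<Sum>k\<le>n. M k l * W_adj4 n m t k l)"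
      unfolding W_adj4_transpose[of m n t] .
    then show ?thesis by (subst sum.swap)
  qed
qed

section \<open>Separable matrices\<close>

text \<open>The half-angle formulas: \<open>u\<^sub>0\<^sup>2 = (y\<^sub>0 + y\<^sub>1) / 2\<close> and \<open>u' = y' / (2 u\<^sub>0)\<close>. In the antipodal direction
  \<open>y\<^sub>0 + y\<^sub>1 = 0\<close> every \<open>u\<close> with \<open>u\<^sub>0 = 0\<close> and the right norm works, and \<open>n \<ge> 2\<close> is needed to have one.\<close>

lemma ex_null_vec:
  assumes n: "2 \<le> n" and null: "minkowski n y y = 0" and y0: "0 \<le> y 0"
  shows "\<exists>u. \<forall>k\<le>n. y k = null_vec n u k"
proof -
  define s where "s = y 0 + y 1"
  have tail_inner_y: "tail_inner n (tail y) (tail y) = s * (y 0 - y 1)"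
    using null n by (simp add: minkowski_split s_def algebra_simps)
  have "\<bar>y 1\<bar>\<^sup>2 \<le> (y 0)\<^sup>2"
    using tail_inner_self_nonneg[of n "tail y"] unfolding tail_inner_y s_def by (simp add: power2_eq_square algebra_simps)
  then have "\<bar>y 1\<bar> \<le> y 0" using y0 by (rule power2_le_imp_le)
  then have "0 \<le> s" by (simp add: s_def)
  show ?thesis
  proof (cases "s = 0")
    case True
    define u where "u k = (if k = 1 then sqrt (y 0) else 0)" for k :: nat
    have "tail_inner n u u = (\<Sum>i\<in>{1..<n}. if i = 1 then y 0 else 0)"
      unfolding tail_inner_def by (intro sum.cong) (auto simp: u_def y0)
    then have tail_inner_u: "tail_inner n u u = y 0" using n by simp
    have "(\<Sum>i\<in>{1..<n}. (tail y i)\<^sup>2) = 0"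
      using tail_inner_y True by (simp add: tail_inner_def power2_eq_square)
    then have tail0: "tail y i = 0" if "i \<in> {1..<n}" for i using that by (simp add: sum_nonneg_eq_0_iff)
    have "y k = null_vec n u k" if "k \<le> n" for k
    proof -
      consider "k = 0" | "k = 1" | "2 \<le> k" by linarith
      then show ?thesis
      proof cases
        case 3
        then have "k - 1 \<in> {1..<n}" using that by auto
        from tail0[OF this] have "y k = 0" using 3 by (simp add: tail_def)
        then show ?thesis using 3 by (simp add: null_vec_def u_def)
      qed (use True in \<open>simp_all add: null_vec_def tail_inner_u s_def\<close>, simp_all add: u_def)
    qed
    then show ?thesis by blast
  next
    case False
    then have s: "0 < s" using \<open>0 \<le> s\<close> by simp
    define r where "r = sqrt (s / 2)"
    have r: "r * r = s / 2" "r \<noteq> 0" using s by (simp_all add: r_def)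
    define u where "u k = (if k = 0 then r else tail y k / (2 * r))" for k
    have "tail_inner n u u = (\<Sum>i\<in>{1..<n}. 1 / (4 * (r * r)) * (tail y i * tail y i))"
      unfolding tail_inner_def by (intro sum.cong) (auto simp: u_def)
    also have "\<dots> = 1 / (2 * s) * tail_inner n (tail y) (tail y)" by (simp add: tail_inner_def sum_distrib_left r)
    finally have tail_inner_u: "tail_inner n u u = (y 0 - y 1) / 2" unfolding tail_inner_y using s by simp
    have u0: "(u 0)\<^sup>2 = s / 2" by (simp add: u_def power2_eq_square r)
    have "y k = null_vec n u k" if "k \<le> n" for k
    proof -
      consider "k = 0" | "k = 1" | "2 \<le> k" by linarith
      then show ?thesis
      proof cases
        case 3
        then show ?thesis using r by (simp add: null_vec_def u_def tail_def)
      qed (simp_all add: null_vec_def tail_inner_u u0 s_def field_simps)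
    qed
    then show ?thesis by blast
  qed
qed

text \<open>With the spatial part of \<open>y\<close> equal to \<open>r d\<close>, where \<open>d\<close> is a unit vector, \<open>y\<close> is the sum of the two
  null vectors \<open>(y\<^sub>0 \<plusminus> r) / 2 * (1, \<plusminus> d)\<close>.\<close>

lemma ex_sum_null_vec:
  assumes n: "2 \<le> n" and y: "forward n y"
  shows "\<exists>u v. \<forall>k\<le>n. y k = null_vec n u k + null_vec n v k"
proof -
  define q where "q = (\<Sum>i=1..n. (y i)\<^sup>2)"
  have q: "0 \<le> q" "q \<le> (y 0)\<^sup>2" and y0: "0 \<le> y 0" using y by (auto simp: forward_iff q_def sum_nonneg)
  define r where "r = sqrt q"
  have r: "0 \<le> r" "r \<le> y 0" "r\<^sup>2 = q" using q y0 by (simp_all add: r_def real_le_lsqrt)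
  obtain d where d: "(\<Sum>i=1..n. (d i)\<^sup>2) = 1" "\<And>i. i \<in> {1..n} \<Longrightarrow> y i = r * d i"
  proof (cases "r = 0")
    case True
    have "(\<Sum>i=1..n. (y i)\<^sup>2) = 0" using True r by (simp add: q_def)
    then have "\<And>i. i \<in> {1..n} \<Longrightarrow> y i = 0" by (simp add: sum_nonneg_eq_0_iff)
    moreover have "(\<Sum>i=1..n. (coord 1 i)\<^sup>2) = 1"
    proof -
      have "(coord 1 i)\<^sup>2 = 1 * coord 1 i" for i by (simp add: coord_def)
      then have "(\<Sum>i=1..n. (coord 1 i)\<^sup>2) = (\<Sum>i=1..n. 1 * coord 1 i)" by (simp only:)
      then show ?thesis using sum_mult_indicator[of "{1..n}" "\<lambda>_. 1" 1] n by simp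
    qed
    ultimately show ?thesis using True that[of "coord 1"] by auto
  next
    case False
    have "(\<Sum>i=1..n. (y i / r)\<^sup>2) = q / r\<^sup>2" by (simp add: q_def power_divide sum_divide_distrib)
    also have "\<dots> = 1" using False r(3)[symmetric] by simp
    finally show ?thesis using False that[of "\<lambda>i. y i / r"] by auto
  qed
  define x where "x s i = (y 0 + s * r) / 2 * (if i = 0 then 1 else s * d i)" for s i
  have "\<exists>u. \<forall>k\<le>n. x s k = null_vec n u k" if s: "s = 1 \<or> s = -1" for s
  proof (rule ex_null_vec[OF n])
    have s2: "s * s = 1" using s by auto
    have "(\<Sum>i=1..n. x s i * x s i) = (\<Sum>i=1..n. ((y 0 + s * r) / 2)\<^sup>2 * (d i)\<^sup>2)"
      using s2 by (intro sum.cong) (auto simp: x_def power2_eq_square)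
    also have "\<dots> = ((y 0 + s * r) / 2)\<^sup>2" by (simp only: sum_distrib_left[symmetric] d(1) mult_1_right)
    finally show "minkowski n (x s) (x s) = 0" by (simp add: minkowski_def) (simp add: x_def power2_eq_square)
    show "0 \<le> x s 0" using s r y0 by (auto simp: x_def)
  qed
  from this[of 1] this[of "-1"] obtain u v where "\<forall>k\<le>n. x 1 k = null_vec n u k" "\<forall>k\<le>n. x (-1) k = null_vec n v k"
    by auto
  moreover have "y k = x 1 k + x (-1) k" if "k \<le> n" for k
    using that d(2)[of k] by (cases "k = 0") (simp_all add: x_def field_simps)
  ultimately show ?thesis by auto
qed

text \<open>The image under the adjoint of \<open>W\<close> of the section of the positive semidefinite cone by the space of
  block-symmetric arrays.\<close>

definition section_image :: "nat \<Rightarrow> nat \<Rightarrow> (nat \<Rightarrow> nat \<Rightarrow> real) \<Rightarrow> bool" where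
  "section_image n m s \<longleftrightarrow> (\<exists>t. psd4 n m t \<and> block_symmetric n m t \<and> (\<forall>k\<le>n. \<forall>l\<le>m. s k l = W_adj4 n m t k l))"

lemma section_image_0: "section_image n m (\<lambda>k l. 0)"
  unfolding section_image_def
  by (rule exI[of _ "\<lambda>i a j b. 0"]) (simp add: psd4_def block_symmetric_def W_adj4_def form4_def)

lemma section_image_add:
  assumes "section_image n m s" "section_image n m s'"
  shows "section_image n m (\<lambda>k l. s k l + s' k l)"
proof -
  obtain t t' where t: "psd4 n m t" "block_symmetric n m t" "\<forall>k\<le>n. \<forall>l\<le>m. s k l = W_adj4 n m t k l"
    and t': "psd4 n m t'" "block_symmetric n m t'" "\<forall>k\<le>n. \<forall>l\<le>m. s' k l = W_adj4 n m t' k l"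
    using assms unfolding section_image_def by blast
  let ?t = "\<lambda>i a j b. t i a j b + t' i a j b"
  have "psd4 n m ?t" using t(1) t'(1) by (simp add: psd4_def form4_add_right)
  moreover have "block_symmetric n m ?t"
    unfolding block_symmetric_def
    by (intro allI impI conjI arg_cong2[of _ _ _ _ "(+)"] block_symmetricD(1,2)[OF t(2)] block_symmetricD(1,2)[OF t'(2)])
  moreover have "\<forall>k\<le>n. \<forall>l\<le>m. s k l + s' k l = W_adj4 n m ?t k l"
    using t(3) t'(3) by (simp add: W_adj4_def form4_add_right)
  ultimately show ?thesis unfolding section_image_def by blast
qed

lemma section_image_null_vec:
  assumes "1 \<le> n" "1 \<le> m"
  shows "section_image n m (\<lambda>k l. null_vec n u k * null_vec m v l)"
proof -
  let ?t = "\<lambda>i a j b. u i * v a * u j * v b"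
  have "form4 n m (\<lambda>i a j b. G i a * G j b) ?t = (\<Sum>i<n. \<Sum>a<m. G i a * u i * v a)\<^sup>2" for G
  proof -
    have "(\<Sum>i<n. \<Sum>a<m. G i a * u i * v a)\<^sup>2
        = (\<Sum>i<n. \<Sum>a<m. G i a * u i * v a * (\<Sum>j<n. \<Sum>b<m. G j b * u j * v b))"
      unfolding power2_eq_square by (simp only: sum_distrib_right)
    also have "\<dots> = form4 n m (\<lambda>i a j b. G i a * G j b) ?t"
      unfolding form4_def by (simp only: sum_distrib_left) (intro sum.cong refl, simp)
    finally show ?thesis ..
  qed
  then have "psd4 n m ?t" by (simp add: psd4_def)
  moreover have "block_symmetric n m ?t" by (simp add: block_symmetric_def)
  ultimately show ?thesis
    unfolding section_image_def using W_adj4_pure[OF assms, of _ _ u v] by (intro exI[of _ ?t]) auto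
qed

lemma section_image_cong:
  "section_image n m s \<Longrightarrow> (\<And>k l. k \<le> n \<Longrightarrow> l \<le> m \<Longrightarrow> s' k l = s k l) \<Longrightarrow> section_image n m s'"
  unfolding section_image_def by auto

lemma section_image_rank_one:
  assumes n: "2 \<le> n" and m: "2 \<le> m" and "forward n y" "forward m x"
  shows "section_image n m (\<lambda>k l. y k * x l)"
proof -
  obtain u v where y: "\<And>k. k \<le> n \<Longrightarrow> y k = null_vec n u k + null_vec n v k"
    using ex_sum_null_vec[OF n] assms(3) by blast
  obtain u' v' where x: "\<And>l. l \<le> m \<Longrightarrow> x l = null_vec m u' l + null_vec m v' l"
    using ex_sum_null_vec[OF m] assms(4) by blast
  have nm: "1 \<le> n" "1 \<le> m" using n m by simp_all
  show ?thesis
    by (rule section_image_cong[OF section_image_add[OF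
          section_image_add[OF section_image_null_vec[OF nm, of u u'] section_image_null_vec[OF nm, of u v']]
          section_image_add[OF section_image_null_vec[OF nm, of v u'] section_image_null_vec[OF nm, of v v']]]])
      (simp add: x y algebra_simps)
qed

lemma section_image_if_separable:
  assumes "2 \<le> n" "2 \<le> m" and "\<And>k. k < N \<Longrightarrow> forward n (y k)" "\<And>k. k < N \<Longrightarrow> forward m (x k)"
  shows "section_image n m (\<lambda>i j. \<Sum>k<(N::nat). y k i * x k j)"
  using assms(3,4)
proof (induction N)
  case (Suc N)
  then have "section_image n m (\<lambda>i j. (\<Sum>k<N. y k i * x k j) + y N i * x N j)"
    by (intro section_image_add section_image_rank_one assms(1,2)) auto
  then show ?case by simp
qed (simp add: section_image_0)

lemma forward_abs_le:
  assumes "forward n y" "i \<le> n"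
  shows "\<bar>y i\<bar> \<le> y 0"
proof (cases "i = 0")
  case False
  have "\<bar>y i\<bar>\<^sup>2 \<le> (\<Sum>i=1..n. (y i)\<^sup>2)" using False assms(2) by (simp, intro member_le_sum) auto
  also have "\<dots> \<le> (y 0)\<^sup>2" using assms(1) by (simp add: forward_iff)
  finally have "\<bar>y i\<bar>\<^sup>2 \<le> (y 0)\<^sup>2" .
  moreover have "0 \<le> y 0" using assms(1) by (simp add: forward_def)
  ultimately show ?thesis by (rule power2_le_imp_le)
qed (use assms in \<open>auto simp: forward_def\<close>)

lemma forward_scale: "forward n y \<Longrightarrow> 0 \<le> r \<Longrightarrow> forward n (\<lambda>i. r * y i)"
  using minkowski_combination_self[of n r y 0 y] by (simp add: forward_def)

lemma forward_limit:
  assumes "\<And>k. forward n (f k)" "\<And>i. i \<le> n \<Longrightarrow> (\<lambda>k. f k i) \<longlonglongrightarrow> l i"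
  shows "forward n l"
proof -
  have "(\<lambda>k. minkowski n (f k) (f k)) \<longlonglongrightarrow> minkowski n l l"
    unfolding minkowski_def using assms(2) by (intro tendsto_intros) auto
  then have "0 \<le> minkowski n l l" using assms(1) by (intro LIMSEQ_le_const) (auto simp: forward_def)
  moreover have "0 \<le> l 0" using assms by (intro LIMSEQ_le_const[of "\<lambda>k. f k 0"]) (auto simp: forward_def)
  ultimately show ?thesis by (simp add: forward_def)
qed

text \<open>The products \<open>y x\<^sup>T\<close> of cone vectors, described by their first row and column. In this form closedness
  under limits is evident; the inequality serves to exclude nonzero matrices with zero corner entry.\<close>

definition rank_one_tensors :: "nat \<Rightarrow> nat \<Rightarrow> (nat \<times> nat \<Rightarrow> real) set" where
  "rank_one_tensors n m = {c. forward n (\<lambda>i. c (i, 0)) \<and> forward m (\<lambda>j. c (0, j)) \<and>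
     (\<forall>i\<le>n. \<forall>j\<le>m. c (i, j) * c (0, 0) = c (i, 0) * c (0, j) \<and> \<bar>c (i, j)\<bar> \<le> c (0, 0))}"

lemma rank_one_tensorsD:
  assumes "c \<in> rank_one_tensors n m"
  shows "forward n (\<lambda>i. c (i, 0))" "forward m (\<lambda>j. c (0, j))"
    and "i \<le> n \<Longrightarrow> j \<le> m \<Longrightarrow> c (i, j) * c (0, 0) = c (i, 0) * c (0, j)"
    and "i \<le> n \<Longrightarrow> j \<le> m \<Longrightarrow> \<bar>c (i, j)\<bar> \<le> c (0, 0)"
  using assms unfolding rank_one_tensors_def by blast+

lemma rank_one_tensors_factor:
  assumes c: "c \<in> rank_one_tensors n m"
  shows "forward n (\<lambda>i. c (i, 0))" "forward m (\<lambda>j. 1 / c (0, 0) * c (0, j))"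
    and "i \<le> n \<Longrightarrow> j \<le> m \<Longrightarrow> c (i, j) = c (i, 0) * (1 / c (0, 0) * c (0, j))"
proof -
  show "forward n (\<lambda>i. c (i, 0))" by (rule rank_one_tensorsD(1)[OF c])
  then have c00: "0 \<le> c (0, 0)" by (simp add: forward_def)
  then show "forward m (\<lambda>j. 1 / c (0, 0) * c (0, j))"
    by (intro forward_scale rank_one_tensorsD(2)[OF c]) simp
  show "c (i, j) = c (i, 0) * (1 / c (0, 0) * c (0, j))" if "i \<le> n" "j \<le> m"
  proof -
    have "c (i, j) * c (0, 0) = c (i, 0) * c (0, j)" "\<bar>c (i, j)\<bar> \<le> c (0, 0)"
      using rank_one_tensorsD(3,4)[OF c that] by blast+
    then show "c (i, j) = c (i, 0) * (1 / c (0, 0) * c (0, j))"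
      by (cases "c (0, 0) = 0") (auto simp: field_simps)
  qed
qed

lemma rank_one_tensorsI:
  assumes "forward n y" "forward m x"
  shows "(\<lambda>(i, j). y i * x j) \<in> rank_one_tensors n m"
proof -
  have pos: "0 \<le> y 0" "0 \<le> x 0" using assms by (auto simp: forward_def)
  have f: "forward n (\<lambda>i. x 0 * y i)" "forward m (\<lambda>j. y 0 * x j)"
    using assms pos by (simp_all add: forward_scale)
  have "\<bar>y i * x j\<bar> \<le> y 0 * x 0" if "i \<le> n" "j \<le> m" for i j
    using forward_abs_le[OF assms(1) that(1)] forward_abs_le[OF assms(2) that(2)] pos
    by (simp add: abs_mult mult_mono)
  then show ?thesis using f unfolding rank_one_tensors_def by (simp add: mult.commute)
qed

text \<open>A functional separating \<open>s\<close> from the separable cone is a Lorentz-positive matrix, and those pair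
  nonnegatively with the section image.\<close>

lemma separable_if_section_image:
  assumes n: "1 \<le> n" and m: "1 \<le> m" and s: "section_image n m s"
  shows "\<exists>(N::nat) y x. (\<forall>k<N. forward n (y k) \<and> forward m (x k)) \<and>
    (\<forall>i\<le>n. \<forall>j\<le>m. s i j = (\<Sum>k<N. y k i * x k j))"
proof (rule ccontr)
  assume not_sep: "\<not> ?thesis"
  define I where "I = {..n} \<times> {..m}"
  define C where "C = rank_one_tensors n m"
  have "\<exists>M. (\<forall>c\<in>C. 0 \<le> (\<Sum>x\<in>I. M x * c x)) \<and> (\<Sum>x\<in>I. M x * case_prod s x) < 0"
  proof (rule separation_from_conic_hull[of I C "(0, 0)" "case_prod s"])
    show "finite I" "(0, 0) \<in> I" by (simp_all add: I_def)
    show "(\<lambda>_. 0) \<in> C" by (simp add: C_def rank_one_tensors_def forward_def minkowski_def)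
  next
    fix c :: "nat \<times> nat \<Rightarrow> real" and r :: real assume c: "c \<in> C" and r: "0 \<le> r"
    note c = rank_one_tensorsD[OF c[unfolded C_def]]
    have "(r * c (i, j)) * (r * c (0, 0)) = (r * c (i, 0)) * (r * c (0, j))" if "i \<le> n" "j \<le> m" for i j
    proof -
      have "(r * c (i, j)) * (r * c (0, 0)) = r * r * (c (i, j) * c (0, 0))" by simp
      then show ?thesis unfolding c(3)[OF that] by simp
    qed
    moreover have "\<bar>r * c (i, j)\<bar> \<le> r * c (0, 0)" if "i \<le> n" "j \<le> m" for i j
      using mult_left_mono[OF c(4)[OF that] r] r by (simp add: abs_mult)
    ultimately show "(\<lambda>x. r * c x) \<in> C"
      unfolding C_def rank_one_tensors_def using forward_scale[OF c(1) r] forward_scale[OF c(2) r] by blast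
  next
    fix c x assume "c \<in> C" "x \<in> I"
    then show "\<bar>c x\<bar> \<le> c (0, 0)" using rank_one_tensorsD(4)[of c n m] by (auto simp: C_def I_def)
  next
    fix f :: "nat \<Rightarrow> nat \<times> nat \<Rightarrow> real"
    assume f: "\<And>k. f k \<in> C" and "\<And>x. x \<in> I \<Longrightarrow> convergent (\<lambda>k. f k x)"
    then obtain l where l: "\<And>x. x \<in> I \<Longrightarrow> (\<lambda>k. f k x) \<longlonglongrightarrow> l x"
      unfolding convergent_def by metis
    note f = rank_one_tensorsD[OF f[unfolded C_def]]
    have lim: "(\<lambda>k. f k (i, j)) \<longlonglongrightarrow> l (i, j)" if "i \<le> n" "j \<le> m" for i j
      using l that by (simp add: I_def)
    have "forward n (\<lambda>i. l (i, 0))"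
      by (rule forward_limit[of n "\<lambda>k i. f k (i, 0)"]) (simp_all only: f(1) lim le0)
    moreover have "forward m (\<lambda>j. l (0, j))"
      by (rule forward_limit[of m "\<lambda>k j. f k (0, j)"]) (simp_all only: f(2) lim le0)
    moreover have "l (i, j) * l (0, 0) = l (i, 0) * l (0, j)" if "i \<le> n" "j \<le> m" for i j
    proof (rule LIMSEQ_unique)
      show "(\<lambda>k. f k (i, j) * f k (0, 0)) \<longlonglongrightarrow> l (i, j) * l (0, 0)"
        using lim that by (intro tendsto_mult) auto
      show "(\<lambda>k. f k (i, j) * f k (0, 0)) \<longlonglongrightarrow> l (i, 0) * l (0, j)"
        unfolding f(3)[OF that] using lim that by (intro tendsto_mult) auto
    qed
    moreover have "\<bar>l (i, j)\<bar> \<le> l (0, 0)" if "i \<le> n" "j \<le> m" for i j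
    proof (rule LIMSEQ_le)
      show "(\<lambda>k. \<bar>f k (i, j)\<bar>) \<longlonglongrightarrow> \<bar>l (i, j)\<bar>" using lim that by (intro tendsto_rabs) auto
      show "(\<lambda>k. f k (0, 0)) \<longlonglongrightarrow> l (0, 0)" using lim by simp
      show "\<exists>N. \<forall>k\<ge>N. \<bar>f k (i, j)\<bar> \<le> f k (0, 0)" using f(4)[OF that] by blast
    qed
    ultimately have "l \<in> C" unfolding C_def rank_one_tensors_def by blast
    then show "\<exists>l\<in>C. \<forall>x\<in>I. (\<lambda>k. f k x) \<longlonglongrightarrow> l x" using l by blast
  next
    fix N and c :: "nat \<Rightarrow> nat \<times> nat \<Rightarrow> real"
    assume "\<And>k. c k \<in> C"
    note c = rank_one_tensors_factor[OF this[unfolded C_def]]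
    show "\<not> (\<forall>x\<in>I. case_prod s x = (\<Sum>k<N. c k x))"
    proof
      assume *: "\<forall>x\<in>I. case_prod s x = (\<Sum>k<N. c k x)"
      have "s i j = (\<Sum>k<N. c k (i, 0) * (1 / c k (0, 0) * c k (0, j)))" if ij: "i \<le> n" "j \<le> m" for i j
      proof -
        have "s i j = (\<Sum>k<N. c k (i, j))" using * ij by (auto simp: I_def)
        also have "\<dots> = (\<Sum>k<N. c k (i, 0) * (1 / c k (0, 0) * c k (0, j)))"
          by (rule sum.cong[OF refl], rule c(3)[OF ij])
        finally show ?thesis .
      qed
      then show False
        using not_sep c(1,2)
        by (elim notE, intro exI[of _ N] exI[of _ "\<lambda>k i. c k (i, 0)"] exI[of _ "\<lambda>k j. 1 / c k (0, 0) * c k (0, j)"])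
          blast
    qed
  qed
  then obtain M where M: "\<And>c. c \<in> C \<Longrightarrow> 0 \<le> (\<Sum>x\<in>I. M x * c x)"
      and neg: "(\<Sum>x\<in>I. M x * case_prod s x) < 0" by blast
  define L where "L = curry M"
  have sum_I: "(\<Sum>x\<in>I. M x * F x) = (\<Sum>i\<le>n. \<Sum>j\<le>m. L i j * F (i, j))" for F
    unfolding I_def L_def sum.cartesian_product by (intro sum.cong) auto
  have "lorentz_positive n m L"
    unfolding lorentz_positive_def euclid_mat_app_sum
  proof (intro allI impI)
    fix x y assume "forward n y" "forward m x"
    then show "0 \<le> (\<Sum>i\<le>n. \<Sum>j\<le>m. L i j * y i * x j)"
      using M[unfolded C_def, OF rank_one_tensorsI, of y x] by (simp add: sum_I mult.assoc)
  qed
  moreover obtain t where t: "psd4 n m t" "block_symmetric n m t" "\<forall>k\<le>n. \<forall>l\<le>m. s k l = W_adj4 n m t k l"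
    using s unfolding section_image_def by blast
  ultimately have "0 \<le> (\<Sum>k\<le>n. \<Sum>l\<le>m. L k l * s k l)"
    using pairing_W_adj4_nonneg[OF n m, of L t] by simp
  then show False using neg by (simp add: sum_I)
qed

section \<open>Kronecker products and block structure\<close>

definition block_array :: "nat \<Rightarrow> real mat \<Rightarrow> nat \<Rightarrow> nat \<Rightarrow> nat \<Rightarrow> nat \<Rightarrow> real" where
  "block_array m T i a j b = T $$ (i * m + a, j * m + b)"

lemma block_index_less: "i < n \<Longrightarrow> a < m \<Longrightarrow> i * m + a < n * (m::nat)"
proof -
  assume "i < n" "a < m"
  then have "i * m + a < Suc i * m" by simp
  also have "\<dots> \<le> n * m" using \<open>i < n\<close> by (intro mult_le_mono1) simp
  finally show ?thesis .
qed

lemma sum_blocks: "(\<Sum>p<n * m. f p) = (\<Sum>i<n. \<Sum>a<m. f (i * m + a))" for f :: "nat \<Rightarrow> real"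
proof -
  have "(\<Sum>p\<in>{i * m..<i * m + m}. f p) = (\<Sum>a<m. f (i * m + a))" for i
    using sum.shift_bounds_nat_ivl[of f 0 "i * m" m] by (simp add: atLeast0LessThan add.commute)
  then show ?thesis by (simp add: sum.nat_group[symmetric])
qed

lemma mat_inner_kron:
  assumes T: "T \<in> carrier_mat (n * m) (n * m)" and B: "B \<in> carrier_mat n n" and D: "D \<in> carrier_mat m m"
  shows "mat_inner T (kron B D) = form4 n m (\<lambda>i a j b. B $$ (i, j) * D $$ (a, b)) (block_array m T)"
proof -
  have K: "kron B D \<in> carrier_mat (n * m) (n * m)" using B D by (simp add: kron_def)
  have entry: "kron B D $$ (i * m + a, j * m + b) = B $$ (i, j) * D $$ (a, b)"
    if "i < n" "a < m" "j < n" "b < m" for i a j b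
    using that B D block_index_less[of i n a m] block_index_less[of j n b m] by (simp add: kron_def)
  have "mat_inner T (kron B D) = (\<Sum>p<n * m. \<Sum>q<n * m. T $$ (p, q) * kron B D $$ (p, q))"
    by (rule mat_inner_eq[OF T K])
  also have "\<dots> = (\<Sum>i<n. \<Sum>a<m. \<Sum>j<n. \<Sum>b<m. T $$ (i * m + a, j * m + b) * kron B D $$ (i * m + a, j * m + b))"
    by (simp only: sum_blocks)
  also have "\<dots> = form4 n m (\<lambda>i a j b. B $$ (i, j) * D $$ (a, b)) (block_array m T)"
    unfolding form4_def block_array_def by (intro sum.cong refl) (simp add: entry)
  finally show ?thesis .
qed

lemma quadratic_form_block_array:
  assumes T: "T \<in> carrier_mat (n * m) (n * m)" and v: "v \<in> carrier_vec (n * m)"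
  shows "v \<bullet> (T *\<^sub>v v) = form4 n m (\<lambda>i a j b. v $ (i * m + a) * v $ (j * m + b)) (block_array m T)"
proof -
  have "v \<bullet> (T *\<^sub>v v) = (\<Sum>p<n * m. \<Sum>q<n * m. v $ p * (T $$ (p, q) * v $ q))"
    using T v by (simp add: scalar_prod_def atLeast0LessThan sum_distrib_left)
  also have "\<dots> = (\<Sum>i<n. \<Sum>a<m. \<Sum>j<n. \<Sum>b<m. v $ (i * m + a) * (T $$ (i * m + a, j * m + b) * v $ (j * m + b)))"
    by (simp only: sum_blocks)
  also have "\<dots> = form4 n m (\<lambda>i a j b. v $ (i * m + a) * v $ (j * m + b)) (block_array m T)"
    unfolding form4_def block_array_def by (intro sum.cong refl) simp
  finally show ?thesis .
qed

lemma W_adj_block_array: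
  assumes T: "T \<in> carrier_mat (n * m) (n * m)" and "k \<le> n" "l \<le> m"
  shows "W_adj n m T $$ (k, l) = W_adj4 n m (block_array m T) k l"
proof -
  have W_coeff: "lorentz_W (unit_vec (r + 1) k) $$ (i, j) = W_coeff k i j" if "i < r" "j < r" "k \<le> r" for r k i j
    using that by (simp add: lorentz_W_def W_coeff_def coord_def unit_vec_def)
  have "W_adj n m T $$ (k, l) = mat_inner T (kron (lorentz_W (unit_vec (n + 1) k)) (lorentz_W (unit_vec (m + 1) l)))"
    using assms by (simp add: W_adj_def W_basis_def)
  also have "\<dots> = form4 n m (\<lambda>i a j b. lorentz_W (unit_vec (n + 1) k) $$ (i, j) * lorentz_W (unit_vec (m + 1) l) $$ (a, b)) (block_array m T)"
    by (rule mat_inner_kron[OF T]) (simp_all add: lorentz_W_def)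
  also have "\<dots> = W_adj4 n m (block_array m T) k l"
    unfolding W_adj4_def form4_def by (intro sum.cong refl) (simp only: W_coeff assms lessThan_iff)
  finally show ?thesis .
qed

lemma psd_mat_iff_block_array:
  assumes T: "T \<in> carrier_mat (n * m) (n * m)"
  shows "psd_mat T \<longleftrightarrow> transpose_mat T = T \<and> psd4 n m (block_array m T)"
proof -
  have "(\<forall>v \<in> carrier_vec (n * m). 0 \<le> v \<bullet> (T *\<^sub>v v)) \<longleftrightarrow> psd4 n m (block_array m T)"
  proof
    assume *: "\<forall>v \<in> carrier_vec (n * m). 0 \<le> v \<bullet> (T *\<^sub>v v)"
    show "psd4 n m (block_array m T)"
      unfolding psd4_def
    proof
      fix G :: "nat \<Rightarrow> nat \<Rightarrow> real"
      define v where "v = Matrix.vec (n * m) (\<lambda>p. G (p div m) (p mod m))"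
      have v: "v \<in> carrier_vec (n * m)" by (simp add: v_def)
      have "0 \<le> v \<bullet> (T *\<^sub>v v)" using * v by blast
      also have "\<dots> = form4 n m (\<lambda>i a j b. G i a * G j b) (block_array m T)"
        unfolding quadratic_form_block_array[OF T v] form4_def
        by (intro sum.cong refl) (simp add: v_def block_index_less)
      finally show "0 \<le> form4 n m (\<lambda>i a j b. G i a * G j b) (block_array m T)" .
    qed
  next
    assume "psd4 n m (block_array m T)"
    then show "\<forall>v \<in> carrier_vec (n * m). 0 \<le> v \<bullet> (T *\<^sub>v v)"
      using quadratic_form_block_array[OF T] by (simp add: psd4_nonneg_sum_square)
  qed
  then show ?thesis using T by (simp add: psd_mat_def sym_mats_def)
qed

lemma block_array_symmetric_iff:
  assumes T: "T \<in> carrier_mat (n * m) (n * m)"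
  shows "transpose_mat T = T \<longleftrightarrow> (\<forall>i<n. \<forall>a<m. \<forall>j<n. \<forall>b<m. block_array m T i a j b = block_array m T j b i a)"
proof
  assume *: "transpose_mat T = T"
  have "block_array m T i a j b = block_array m T j b i a" if "i < n" "a < m" "j < n" "b < m" for i a j b
  proof -
    have "transpose_mat T $$ (i * m + a, j * m + b) = T $$ (j * m + b, i * m + a)"
      using T that by (simp add: block_index_less)
    then show ?thesis unfolding * by (simp add: block_array_def)
  qed
  then show "\<forall>i<n. \<forall>a<m. \<forall>j<n. \<forall>b<m. block_array m T i a j b = block_array m T j b i a" by blast
next
  assume *: "\<forall>i<n. \<forall>a<m. \<forall>j<n. \<forall>b<m. block_array m T i a j b = block_array m T j b i a"
  show "transpose_mat T = T"
  proof (rule eq_matI)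
    fix p q assume pq: "p < dim_row T" "q < dim_col T"
    then have m: "0 < m" using T by (cases m) auto
    have "p div m < n" "p mod m < m" "q div m < n" "q mod m < m"
      using pq T m by (auto simp: less_mult_imp_div_less)
    then have "block_array m T (p div m) (p mod m) (q div m) (q mod m) = block_array m T (q div m) (q mod m) (p div m) (p mod m)"
      using * by blast
    then show "transpose_mat T $$ (p, q) = T $$ (p, q)"
      using pq T by (simp add: block_array_def)
  qed (use T in auto)
qed

text \<open>Exchanging \<open>i\<close> and \<open>j\<close> changes the sign of \<open>B\<close> and leaves \<open>t\<close> alone.\<close>

lemma form4_skew_skew_zero:
  assumes B: "B \<in> skew_mats n" and t: "block_symmetric n m t"
  shows "form4 n m (\<lambda>i a j b. B $$ (i, j) * D $$ (a, b)) t = 0"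
proof -
  have B: "B \<in> carrier_mat n n" "transpose_mat B = - B" using B by (simp_all add: skew_mats_def)
  have skew: "B $$ (j, i) = - B $$ (i, j)" if "i < n" "j < n" for i j
  proof -
    have "B $$ (j, i) = transpose_mat B $$ (i, j)" using B(1) that by simp
    also have "\<dots> = - B $$ (i, j)" unfolding B(2) using B(1) that by simp
    finally show ?thesis .
  qed
  have swap: "B $$ (j, i) * D $$ (a, b) * t j a i b = - (B $$ (i, j) * D $$ (a, b) * t i a j b)"
    if "i < n" "a < m" "j < n" "b < m" for i a j b
    using skew[OF that(1,3)] block_symmetricD(2)[OF t that] by simp
  have "form4 n m (\<lambda>i a j b. B $$ (i, j) * D $$ (a, b)) t
      = (\<Sum>i<n. \<Sum>a<m. \<Sum>j<n. \<Sum>b<m. B $$ (j, i) * D $$ (a, b) * t j a i b)"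
    unfolding form4_def by (rule sum4_swap_outer)
  also have "\<dots> = (\<Sum>i<n. \<Sum>a<m. \<Sum>j<n. \<Sum>b<m. - (B $$ (i, j) * D $$ (a, b) * t i a j b))"
    by (intro sum.cong refl swap) (simp_all only: lessThan_iff)
  also have "\<dots> = - form4 n m (\<lambda>i a j b. B $$ (i, j) * D $$ (a, b)) t"
    by (simp only: form4_def sum_negf)
  finally show ?thesis by simp
qed

lemma mat_inner_add_right:
  assumes "A \<in> carrier_mat p q" "B \<in> carrier_mat p q" "C \<in> carrier_mat p q"
  shows "mat_inner A (B + C) = mat_inner A B + mat_inner A C"
  using assms by (simp add: mat_inner_eq[of _ p q] sum.distrib distrib_left)

lemma mat_inner_smult_right:
  assumes "A \<in> carrier_mat p q" "B \<in> carrier_mat p q"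
  shows "mat_inner A (r \<cdot>\<^sub>m B) = r * mat_inner A B"
  using assms by (simp add: mat_inner_eq[of _ p q] sum_distrib_left mult_ac)

lemma mat_inner_zero_right:
  assumes "A \<in> carrier_mat p q"
  shows "mat_inner A (0\<^sub>m p q) = 0"
  using assms by (simp add: mat_inner_eq[of _ p q])

text \<open>Testing against the Kronecker product of the skew matrices \<open>e\<^sub>i e\<^sub>j\<^sup>T - e\<^sub>j e\<^sub>i\<^sup>T\<close> and
  \<open>e\<^sub>a e\<^sub>b\<^sup>T - e\<^sub>b e\<^sub>a\<^sup>T\<close> gives twice the difference of the entries to be compared.\<close>

lemma orthogonal_skew_tensor_iff:
  assumes T: "T \<in> carrier_mat (n * m) (n * m)" and sym: "transpose_mat T = T"
  shows "(\<forall>J \<in> skew_tensor n m. mat_inner T J = 0) \<longleftrightarrow> block_symmetric n m (block_array m T)"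
proof -
  define X where "X = {kron B D | B D. B \<in> skew_mats n \<and> D \<in> skew_mats m}"
  define V where "V = module_mat TYPE(real) (n * m) (n * m)"
  interpret vs: vectorspace "class_ring :: real ring" V unfolding V_def by (rule matrix_vs)
  have X: "X \<subseteq> carrier V"
    by (auto simp: X_def V_def matrix_vs_simps skew_mats_def kron_def)
  have span: "skew_tensor n m = vs.span X" by (simp add: skew_tensor_def X_def V_def)
  have sym4: "block_array m T i a j b = block_array m T j b i a" if "i < n" "a < m" "j < n" "b < m" for i a j b
    using sym that block_array_symmetric_iff[OF T] by blast
  show ?thesis
  proof
    assume orth: "\<forall>J \<in> skew_tensor n m. mat_inner T J = 0"
    have "block_array m T i a j b = block_array m T j a i b" if ij: "i < n" "a < m" "j < n" "b < m" for i a j b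
    proof -
      define E where "E r i j = Matrix.mat r r (\<lambda>(i', j'). coord i i' * coord j j' - coord j i' * coord i j')" for r i j
      have skew: "E r i j \<in> skew_mats r" for r i j
        by (auto simp: E_def skew_mats_def)
      then have "kron (E n i j) (E m a b) \<in> X" unfolding X_def by blast
      then have "kron (E n i j) (E m a b) \<in> skew_tensor n m"
        using vs.in_own_span[OF X] span by blast
      then have "0 = mat_inner T (kron (E n i j) (E m a b))" using orth by simp
      also have "\<dots> = form4 n m (\<lambda>i' a' j' b'. E n i j $$ (i', j') * E m a b $$ (a', b')) (block_array m T)"
        by (rule mat_inner_kron[OF T]) (simp_all add: E_def)
      also have "\<dots> = form4 n m (block_array m T) (\<lambda>i' a' j' b'. (coord i i' * coord a a' * coord j j' * coord b b'
          + coord j i' * coord b a' * coord i j' * coord a b') + (-1) * (coord j i' * coord a a' * coord i j' * coord b b'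
          + coord i i' * coord b a' * coord j j' * coord a b'))"
        by (rule form4_cong) (simp add: E_def algebra_simps)
      also have "\<dots> = block_array m T i a j b + block_array m T j b i a - (block_array m T j a i b + block_array m T i b j a)"
        by (simp only: form4_add_right form4_scale_right form4_unit ij) simp
      also have "block_array m T j b i a = block_array m T i a j b" using sym4 ij by simp
      also have "block_array m T i b j a = block_array m T j a i b" using sym4 ij by simp
      finally show ?thesis by simp
    qed
    then show "block_symmetric n m (block_array m T)" using sym4 unfolding block_symmetric_def by blast
  next
    assume block: "block_symmetric n m (block_array m T)"
    define N where "N = {J \<in> carrier_mat (n * m) (n * m). mat_inner T J = 0}"
    have "submodule class_ring N V"
    proof (rule submodule.intro)
      show "Module.module class_ring V" by (rule vs.module_axioms)
      show "N \<subseteq> carrier V" by (auto simp: N_def V_def matrix_vs_simps)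
      show "\<zero>\<^bsub>V\<^esub> \<in> N" using T by (simp add: N_def V_def matrix_vs_simps mat_inner_zero_right)
    next
      fix A B assume "A \<in> N" "B \<in> N"
      then show "A \<oplus>\<^bsub>V\<^esub> B \<in> N"
        using T by (simp add: N_def V_def matrix_vs_simps mat_inner_add_right)
    next
      fix r and A assume "r \<in> carrier (class_ring :: real ring)" "A \<in> N"
      then show "r \<odot>\<^bsub>V\<^esub> A \<in> N"
        using T by (simp add: N_def V_def matrix_vs_simps mat_inner_smult_right)
    qed
    moreover have "X \<subseteq> N"
    proof
      fix J assume "J \<in> X"
      then obtain B D where J: "J = kron B D" and B: "B \<in> skew_mats n" and D: "D \<in> skew_mats m"
        by (auto simp: X_def)
      then have c: "B \<in> carrier_mat n n" "D \<in> carrier_mat m m" by (auto simp: skew_mats_def)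
      have "mat_inner T J = 0"
        unfolding J mat_inner_kron[OF T c] by (rule form4_skew_skew_zero[OF B block])
      moreover have "J \<in> carrier_mat (n * m) (n * m)" using c by (simp add: J kron_def)
      ultimately show "J \<in> N" by (simp add: N_def)
    qed
    ultimately have "vs.span X \<subseteq> N" using vs.span_is_subset by blast
    then show "\<forall>J \<in> skew_tensor n m. mat_inner T J = 0" unfolding span by (auto simp: N_def)
  qed
qed

lemma lorentz_cone_iff: "y \<in> lorentz_cone (n + 1) \<longleftrightarrow> y \<in> carrier_vec (n + 1) \<and> forward n (\<lambda>i. y $ i)"
  by (auto simp: lorentz_cone_def forward_iff atLeastLessThanSuc_atLeastAtMost)

text \<open>The right-hand side of the theorem in terms of arrays.\<close>

lemma W_adj_section_iff:
  assumes S: "S \<in> carrier_mat (n + 1) (m + 1)"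
  shows "(\<exists>T \<in> carrier_mat (n * m) (n * m).
      psd_mat T \<and> (\<forall>J \<in> skew_tensor n m. mat_inner T J = 0) \<and> S = W_adj n m T)
    \<longleftrightarrow> section_image n m (\<lambda>k l. S $$ (k, l))"
proof
  assume "\<exists>T \<in> carrier_mat (n * m) (n * m).
      psd_mat T \<and> (\<forall>J \<in> skew_tensor n m. mat_inner T J = 0) \<and> S = W_adj n m T"
  then obtain T where T: "T \<in> carrier_mat (n * m) (n * m)" "psd_mat T"
      "\<forall>J \<in> skew_tensor n m. mat_inner T J = 0" "S = W_adj n m T" by blast
  have "transpose_mat T = T" "psd4 n m (block_array m T)" using psd_mat_iff_block_array[OF T(1)] T(2) by auto
  moreover from this have "block_symmetric n m (block_array m T)"
    using orthogonal_skew_tensor_iff[OF T(1)] T(3) by blast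
  ultimately show "section_image n m (\<lambda>k l. S $$ (k, l))"
    unfolding section_image_def T(4) using W_adj_block_array[OF T(1)] by blast
next
  assume "section_image n m (\<lambda>k l. S $$ (k, l))"
  then obtain t where t: "psd4 n m t" "block_symmetric n m t"
      "\<And>k l. k \<le> n \<Longrightarrow> l \<le> m \<Longrightarrow> S $$ (k, l) = W_adj4 n m t k l"
    unfolding section_image_def by blast
  define T where "T = Matrix.mat (n * m) (n * m) (\<lambda>(p, q). t (p div m) (p mod m) (q div m) (q mod m))"
  have T: "T \<in> carrier_mat (n * m) (n * m)" by (simp add: T_def)
  have block_array: "block_array m T i a j b = t i a j b" if "i < n" "a < m" "j < n" "b < m" for i a j b
    using that by (simp add: block_array_def T_def block_index_less)
  have form: "form4 n m Q (block_array m T) = form4 n m Q t" for Q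
    by (rule form4_cong) (simp add: block_array)
  have block: "block_symmetric n m (block_array m T)"
    unfolding block_symmetric_def
  proof (intro allI impI conjI)
    fix i a j b assume *: "i < n" "a < m" "j < n" "b < m"
    show "block_array m T i a j b = block_array m T j b i a" "block_array m T i a j b = block_array m T j a i b"
      using block_symmetricD[OF t(2) *] * by (simp_all add: block_array)
  qed
  then have sym: "transpose_mat T = T"
    using block_array_symmetric_iff[OF T] unfolding block_symmetric_def by blast
  have "psd_mat T" using psd_mat_iff_block_array[OF T] sym t(1) by (simp add: psd4_def form)
  moreover have "\<forall>J \<in> skew_tensor n m. mat_inner T J = 0"
    using orthogonal_skew_tensor_iff[OF T sym] block by blast
  moreover have "S = W_adj n m T"
  proof (rule eq_matI)
    fix k l assume "k < dim_row (W_adj n m T)" "l < dim_col (W_adj n m T)"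
    then have "k \<le> n" "l \<le> m" by (simp_all add: W_adj_def)
    then show "S $$ (k, l) = W_adj n m T $$ (k, l)"
      using t(3) W_adj_block_array[OF T] by (simp add: W_adj4_def form)
  qed (use S in \<open>simp_all add: W_adj_def\<close>)
  ultimately show "\<exists>T \<in> carrier_mat (n * m) (n * m).
      psd_mat T \<and> (\<forall>J \<in> skew_tensor n m. mat_inner T J = 0) \<and> S = W_adj n m T"
    using T by blast
qed

theorem proposition2:
  fixes n m :: nat and S :: "real mat"
  assumes "min n m \<ge> 2"
    and "S \<in> carrier_mat (n + 1) (m + 1)"
  shows "S \<in> lorentz_sep (n + 1) (m + 1) \<longleftrightarrow>
    (\<exists>T \<in> carrier_mat (n * m) (n * m).
       psd_mat T \<and> (\<forall>J \<in> skew_tensor n m. mat_inner T J = 0) \<and> S = W_adj n m T)"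
proof -
  have n: "2 \<le> n" and m: "2 \<le> m" using assms(1) by simp_all
  have nm: "1 \<le> n" "1 \<le> m" using n m by simp_all
  have outer: "outer_prod y x $$ (i, j) = y $ i * x $ j"
    if "y \<in> carrier_vec (n + 1)" "x \<in> carrier_vec (m + 1)" "i \<le> n" "j \<le> m" for y x i j
    using that by (simp add: outer_prod_def)
  have "S \<in> lorentz_sep (n + 1) (m + 1) \<longleftrightarrow> section_image n m (\<lambda>k l. S $$ (k, l))"
  proof
    assume "S \<in> lorentz_sep (n + 1) (m + 1)"
    then obtain N y x where yx: "\<And>k. k < N \<Longrightarrow> y k \<in> lorentz_cone (n + 1)" "\<And>k. k < N \<Longrightarrow> x k \<in> lorentz_cone (m + 1)"
        and S: "S = Matrix.mat (n + 1) (m + 1) (\<lambda>ij. \<Sum>k<(N::nat). outer_prod (y k) (x k) $$ ij)"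
      by (auto simp: lorentz_sep_def)
    note yx = yx[unfolded lorentz_cone_iff]
    have "section_image n m (\<lambda>i j. \<Sum>k<N. y k $ i * x k $ j)"
      by (rule section_image_if_separable[OF n m]) (use yx in blast)+
    then show "section_image n m (\<lambda>k l. S $$ (k, l))"
    proof (rule section_image_cong)
      fix i j assume ij: "i \<le> n" "j \<le> m"
      have "S $$ (i, j) = (\<Sum>k<N. outer_prod (y k) (x k) $$ (i, j))" using ij by (simp add: S)
      also have "\<dots> = (\<Sum>k<N. y k $ i * x k $ j)"
        using yx ij by (intro sum.cong refl outer) blast+
      finally show "S $$ (i, j) = (\<Sum>k<N. y k $ i * x k $ j)" .
    qed
  next
    assume "section_image n m (\<lambda>k l. S $$ (k, l))"
    then obtain N y x where yx: "\<forall>k<(N::nat). forward n (y k) \<and> forward m (x k)"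
        and S: "\<forall>i\<le>n. \<forall>j\<le>m. S $$ (i, j) = (\<Sum>k<N. y k i * x k j)"
      using separable_if_section_image[OF nm] by blast
    define y' where "y' k = Matrix.vec (n + 1) (y k)" for k
    define x' where "x' k = Matrix.vec (m + 1) (x k)" for k
    have forward_vec: "forward r (\<lambda>i. Matrix.vec (r + 1) f $ i) \<longleftrightarrow> forward r f" for r f
      by (simp add: forward_iff)
    have "\<forall>k<N. y' k \<in> lorentz_cone (n + 1) \<and> x' k \<in> lorentz_cone (m + 1)"
      using yx unfolding lorentz_cone_iff y'_def x'_def forward_vec by simp
    moreover have "S = Matrix.mat (n + 1) (m + 1) (\<lambda>ij. \<Sum>k<N. outer_prod (y' k) (x' k) $$ ij)"
    proof (rule eq_matI)
      fix i j assume "i < dim_row (Matrix.mat (n + 1) (m + 1) (\<lambda>ij. \<Sum>k<N. outer_prod (y' k) (x' k) $$ ij))"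
        "j < dim_col (Matrix.mat (n + 1) (m + 1) (\<lambda>ij. \<Sum>k<N. outer_prod (y' k) (x' k) $$ ij))"
      then have ij: "i \<le> n" "j \<le> m" by simp_all
      then show "S $$ (i, j) = Matrix.mat (n + 1) (m + 1) (\<lambda>ij. \<Sum>k<N. outer_prod (y' k) (x' k) $$ ij) $$ (i, j)"
        using S by (simp add: outer_prod_def y'_def x'_def)
    qed (use assms(2) in simp_all)
    ultimately show "S \<in> lorentz_sep (n + 1) (m + 1)" unfolding lorentz_sep_def by blast
  qed
  then show ?thesis using W_adj_section_iff[OF assms(2)] by simp
qed

end
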